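(* Let $X$ be a Banach space and let $\Gamma:[0,1]\to c(X)$ be a positive multifunction. If $\Gamma$ is Denjoy-Pettis integrable in $cb(X)$ (resp. in $cwk(X)$, resp. in $ck(X)$), then $\Gamma$ is Pettis integrable in $cb(X)$ (resp. in $cwk(X)$, resp. in $ck(X)$).
   Context: $X$ is a (real) Banach space with dual $X^*$. $c(X)$ is the family of all nonempty closed convex subsets of $X$; $cb(X)$, $cwk(X)$, $ck(X)$ are the families of all bounded, weakly compact, compact members of $c(X)$, respectively. For $C\in c(X)$ and $x^*\in X^*$, $s(x^*,C)=\sup\{\langle x^*,x\rangle: x\in C\}$ is the support function. The interval $[0,1]$ carries Lebesgue measure $\lambda$; $\mathcal{L}$ is the family of Lebesgue measurable subsets of $[0,1]$ and $\mathcal{I}$ the family of closed subintervals of $[0,1]$. A multifunction is a map $\Gamma:[0,1]\to c(X)$; $s(x^*,\Gamma)$ denotes the function $t\mapsto s(x^*,\Gamma(t))$. $\Gamma$ is positive if for each $x^*\in X^*$ separately, $s(x^*,\Gamma)\ge 0$ a.e. Denjoy integral (in the wide sense, Denjoy-Khintchine): a function $F$ is AC on a set $E$ if for every $\varepsilon>0$ there is $\delta>0$ with $\sum_i|F(d_i)-F(c_i)|<\varepsilon$ for every finite family of nonoverlapping intervals $[c_i,d_i]$ with endpoints in $E$ and $\sum_i(d_i-c_i)<\delta$; $F$ is ACG on $[0,1]$ if it is continuous on $[0,1]$ and $[0,1]$ is a countable union of sets on each of which $F$ is AC. A real function $f$ on $[0,1]$ is Denjoy integrable if there is an ACG function $F$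 whose approximate derivative equals $f$ almost everywhere; then $(D)\int_{[a,b]}f=F(b)-F(a)$. Let $\mathcal{C}\subset c(X)$ be nonempty. $\Gamma:[0,1]\to c(X)$ is Denjoy-Pettis (DP) integrable in $\mathcal{C}$ if $s(x^*,\Gamma)$ is Denjoy integrable for every $x^*\in X^*$ and for each $I\in\mathcal{I}$ there is $N_\Gamma(I)\in\mathcal{C}$ with $s(x^*,N_\Gamma(I))=(D)\int_I s(x^*,\Gamma)$ for all $x^*\in X^*$. $\Gamma$ is Pettis integrable in $\mathcal{C}$ if $s(x^*,\Gamma)$ is Lebesgue integrable for every $x^*\in X^*$ and for each $A\in\mathcal{L}$ there is $M_\Gamma(A)\in\mathcal{C}$ with $s(x^*,M_\Gamma(A))=\int_A s(x^*,\Gamma)\,d\lambda$ for all $x^*\in X^*$. *)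

theory Defs
  imports "HOL-Analysis.Analysis"
begin

section \<open>Hyperspaces and support functions\<close>

definition weak_topology :: "'a::real_normed_vector topology" where
  "weak_topology =
     topology_generated_by {blinfun_apply x' -` U | (x' :: 'a \<Rightarrow>\<^sub>L real) U. open U}"

definition c_sets :: "'a::real_normed_vector set set" where
  "c_sets = {C. C \<noteq> {} \<and> closed C \<and> convex C}"

definition cb_sets :: "'a::real_normed_vector set set" where
  "cb_sets = {C \<in> c_sets. bounded C}"

definition cwk_sets :: "'a::real_normed_vector set set" where
  "cwk_sets = {C \<in> c_sets. compactin weak_topology C}"

definition ck_sets :: "'a::real_normed_vector set set" where
  "ck_sets = {C \<in> c_sets. compact C}"

text \<open>The values of a multifunction may be unbounded, so the supremum is taken in the
  extended reals.\<close>

definition support_fun :: "('a::real_normed_vector \<Rightarrow>\<^sub>L real) \<Rightarrow> 'a set \<Rightarrow> ereal" where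
  "support_fun x' C = (SUP x\<in>C. ereal (blinfun_apply x' x))"

definition positive_multifunction :: "(real \<Rightarrow> 'a::real_normed_vector set) \<Rightarrow> bool" where
  "positive_multifunction \<Gamma> \<longleftrightarrow>
     (\<forall>x'. AE t in lebesgue_on {0..1}. 0 \<le> support_fun x' (\<Gamma> t))"


section \<open>The Denjoy (Denjoy-Khintchine) integral\<close>

text \<open>A finite family of nonoverlapping intervals is a finite set \<open>D\<close> of pairs of endpoints.\<close>

definition AC_on :: "real set \<Rightarrow> (real \<Rightarrow> real) \<Rightarrow> bool" where
  "AC_on E F \<longleftrightarrow>
     (\<forall>\<epsilon>>0. \<exists>\<delta>>0. \<forall>D :: (real \<times> real) set.
        finite D \<longrightarrow>
        (\<forall>(c, d)\<in>D. c < d \<and> c \<in> E \<and> d \<in> E) \<longrightarrow>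
        pairwise (\<lambda>(c, d) (c', d'). {c<..<d} \<inter> {c'<..<d'} = {}) D \<longrightarrow>
        (\<Sum>(c, d)\<in>D. d - c) < \<delta> \<longrightarrow>
        (\<Sum>(c, d)\<in>D. \<bar>F d - F c\<bar>) < \<epsilon>)"

definition ACG :: "(real \<Rightarrow> real) \<Rightarrow> bool" where
  "ACG F \<longleftrightarrow> continuous_on {0..1} F \<and>
     (\<exists>A :: nat \<Rightarrow> real set. (\<Union>n. A n) = {0..1} \<and> (\<forall>n. AC_on (A n) F))"

definition density_point :: "real set \<Rightarrow> real \<Rightarrow> bool" where
  "density_point E t \<longleftrightarrow>
     ((\<lambda>h. measure lebesgue (E \<inter> {t - h..t + h}) / (2 * h)) \<longlongrightarrow> 1) (at_right 0)"

definition has_approx_derivative :: "(real \<Rightarrow> real) \<Rightarrow> real \<Rightarrow> real \<Rightarrow> bool" where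
  "has_approx_derivative F D t \<longleftrightarrow>
     (\<exists>E. E \<in> sets lebesgue \<and> density_point E t \<and>
          ((\<lambda>u. (F u - F t) / (u - t)) \<longlongrightarrow> D) (at t within E))"

text \<open>Support functions of unbounded sets may be infinite, hence the integrand is
  extended real valued.  Since approximate derivatives are real, a function with a
  primitive is finite almost everywhere.  Values of \<open>F\<close> outside \<open>[0,1]\<close> can
  influence the approximate derivative only at the two endpoints, which are negligible.\<close>

definition denjoy_primitive :: "(real \<Rightarrow> real) \<Rightarrow> (real \<Rightarrow> ereal) \<Rightarrow> bool" where
  "denjoy_primitive F f \<longleftrightarrow> ACG F \<and>
     (AE t in lebesgue_on {0..1}. \<exists>D. has_approx_derivative F D t \<and> f t = ereal D)"

definition denjoy_integrable :: "(real \<Rightarrow> ereal) \<Rightarrow> bool" where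
  "denjoy_integrable f \<longleftrightarrow> (\<exists>F. denjoy_primitive F f)"

text \<open>\<open>has_denjoy_integral f a b v\<close> says that \<open>v\<close> is the Denjoy integral of \<open>f\<close> over \<open>[a,b]\<close>;
  it is a relation in the style of \<open>has_integral\<close>, primitives being unique up to a constant.\<close>

definition has_denjoy_integral :: "(real \<Rightarrow> ereal) \<Rightarrow> real \<Rightarrow> real \<Rightarrow> real \<Rightarrow> bool" where
  "has_denjoy_integral f a b v \<longleftrightarrow> (\<exists>F. denjoy_primitive F f \<and> v = F b - F a)"


section \<open>Integrability of multifunctions\<close>

definition DP_integrable_in ::
    "'a::real_normed_vector set set \<Rightarrow> (real \<Rightarrow> 'a set) \<Rightarrow> bool" where
  "DP_integrable_in \<C> \<Gamma> \<longleftrightarrow>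
     (\<forall>x'. denjoy_integrable (\<lambda>t. support_fun x' (\<Gamma> t))) \<and>
     (\<forall>a b. 0 \<le> a \<longrightarrow> a \<le> b \<longrightarrow> b \<le> 1 \<longrightarrow>
        (\<exists>N\<in>\<C>. \<forall>x'. \<exists>v. has_denjoy_integral (\<lambda>t. support_fun x' (\<Gamma> t)) a b v \<and>
                          support_fun x' N = ereal v))"

text \<open>Lebesgue integrability of an extended real valued function on \<open>[0,1]\<close>.  As
  \<open>real_of_ereal\<close> sends infinite values to 0, finiteness almost everywhere is required
  explicitly.\<close>

definition lebesgue_integrable :: "(real \<Rightarrow> ereal) \<Rightarrow> bool" where
  "lebesgue_integrable f \<longleftrightarrow>
     f \<in> borel_measurable (lebesgue_on {0..1}) \<and>
     (AE t in lebesgue_on {0..1}. \<bar>f t\<bar> \<noteq> \<infinity>) \<and>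
     integrable (lebesgue_on {0..1}) (\<lambda>t. real_of_ereal (f t))"

definition Pettis_integrable_in ::
    "'a::real_normed_vector set set \<Rightarrow> (real \<Rightarrow> 'a set) \<Rightarrow> bool" where
  "Pettis_integrable_in \<C> \<Gamma> \<longleftrightarrow>
     (\<forall>x'. lebesgue_integrable (\<lambda>t. support_fun x' (\<Gamma> t))) \<and>
     (\<forall>A\<in>sets lebesgue. A \<subseteq> {0..1} \<longrightarrow>
        (\<exists>M\<in>\<C>. \<forall>x'. support_fun x' M =
           ereal (LINT t:A|lebesgue. real_of_ereal (support_fun x' (\<Gamma> t)))))"

end

theory Submission
  imports Defs
begin

text \<open>
  For a single functional, a Denjoy primitive with nonnegative approximate derivative is
  nondecreasing: after adding a small linear function, an interval of values would otherwise lie in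
  the image of a null set, against Lusin's condition (N), which ACG functions satisfy. By (N) its
  Stieltjes measure is absolutely continuous, so the integrand is Lebesgue integrable with the same
  interval integrals.

  The set-valued integral over a measurable set \<open>A\<close> has to be the set of all \<open>x\<close> with
  \<open>y x \<le> p y\<close> for every functional \<open>y\<close>, where \<open>p y\<close> is the integral over \<open>A\<close> of the support
  function at \<open>y\<close>. It is a closed convex subset of the integral over \<open>[0,1]\<close> and therefore inherits
  boundedness, weak compactness and compactness. What remains is that its support function is \<open>p\<close>,
  a weak-star lower semicontinuity statement that Fatou's lemma gives only along sequences. For
  nets, near-minimisers of the strictly convex functional \<open>h \<mapsto> \<integral> exp (- h)\<close> yield one majorant
  \<open>g\<close> valid for all weak-star neighbourhoods at once, and the assumption on intervals allows
  comparing the support function at the limit with \<open>g\<close>.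
\<close>

section \<open>ACG functions with nonnegative approximate derivative\<close>

text \<open>The points of the space are exactly the weak-star continuous functionals on its dual, so
  a sublinear \<open>p\<close> can be the support function of a set in the space only if it is
  weak-star lower semicontinuous. The dual ball need not be weak-star metrizable, hence nets; an
  almost everywhere statement survives only countably many limits, hence a single \<open>g\<close>
  fixed before the point to be tested. To stay in a bounded part of the dual, \<open>p y\<close> is
  first replaced by \<open>p y + e * norm y\<close>: near-minimisers are then bounded in norm, and
  their support functions are bounded in L1 through the integral over [0,1]. Completeness of the
  space removes the penalty at the end. The integrand \<open>exp (- h)\<close> is bounded for
  nonnegative \<open>h\<close>; this matters because only first moments are available. Positivity
  enters repeatedly: it makes primitives monotone, permits Fatou's lemma, puts 0 among the minorants
  and gives \<open>p A y \<le> p {0..1} y\<close>.\<close>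

lemma AC_on_subset:
  assumes "AC_on E F" "E' \<subseteq> E"
  shows "AC_on E' F"
  unfolding AC_on_def
proof (intro allI impI)
  fix e :: real assume "e > 0"
  then obtain d where "d > 0" and d: "\<And>D. finite D \<Longrightarrow> \<forall>(c, d)\<in>D. c < d \<and> c \<in> E \<and> d \<in> E \<Longrightarrow>
      pairwise (\<lambda>(c, d) (c', d'). {c<..<d} \<inter> {c'<..<d'} = {}) D \<Longrightarrow>
      (\<Sum>(c, d)\<in>D. d - c) < d \<Longrightarrow> (\<Sum>(c, d)\<in>D. \<bar>F d - F c\<bar>) < e"
    using assms(1)[unfolded AC_on_def, rule_format, of e] by auto
  show "\<exists>\<delta>>0. \<forall>D. finite D \<longrightarrow> (\<forall>(c, d)\<in>D. c < d \<and> c \<in> E' \<and> d \<in> E') \<longrightarrow>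
      pairwise (\<lambda>(c, d) (c', d'). {c<..<d} \<inter> {c'<..<d'} = {}) D \<longrightarrow>
      (\<Sum>(c, d)\<in>D. d - c) < \<delta> \<longrightarrow> (\<Sum>(c, d)\<in>D. \<bar>F d - F c\<bar>) < e"
    using \<open>d > 0\<close> assms(2) by (intro exI[of _ d] conjI allI impI d) auto
qed

lemma AC_on_add_linear:
  assumes "AC_on E F"
  shows "AC_on E (\<lambda>t. F t + k * t)"
  unfolding AC_on_def
proof (intro allI impI)
  fix e :: real assume "e > 0"
  then obtain d where "d > 0" and d: "\<And>D. finite D \<Longrightarrow> \<forall>(c, d)\<in>D. c < d \<and> c \<in> E \<and> d \<in> E \<Longrightarrow>
      pairwise (\<lambda>(c, d) (c', d'). {c<..<d} \<inter> {c'<..<d'} = {}) D \<Longrightarrow>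
      (\<Sum>(c, d)\<in>D. d - c) < d \<Longrightarrow> (\<Sum>(c, d)\<in>D. \<bar>F d - F c\<bar>) < e/2"
    using assms[unfolded AC_on_def, rule_format, of "e/2"] by auto
  \<comment> \<open>This bounds the contribution of the linear part by \<open>e / 2\<close>; the
    summand 1 covers \<open>k = 0\<close>.\<close>
  define d' where "d' = min d (e / (2 * (1 + \<bar>k\<bar>)))"
  have "d' > 0" using \<open>d > 0\<close> \<open>e > 0\<close> by (auto simp: d'_def)
  moreover have "(\<Sum>(c, d)\<in>D. \<bar>F d + k * d - (F c + k * c)\<bar>) < e"
    if D: "finite D" "\<forall>(c, d)\<in>D. c < d \<and> c \<in> E \<and> d \<in> E"
      "pairwise (\<lambda>(c, d) (c', d'). {c<..<d} \<inter> {c'<..<d'} = {}) D"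
      "(\<Sum>(c, d)\<in>D. d - c) < d'" for D
  proof -
    have "(\<Sum>(c, d)\<in>D. \<bar>F d + k * d - (F c + k * c)\<bar>)
        \<le> (\<Sum>(c, d)\<in>D. \<bar>F d - F c\<bar> + \<bar>k\<bar> * (d - c))"
    proof (rule sum_mono, clarsimp)
      fix a b assume "(a, b) \<in> D"
      then have "a < b" using D by auto
      have "\<bar>F b + k * b - (F a + k * a)\<bar> \<le> \<bar>F b - F a\<bar> + \<bar>k * (b - a)\<bar>"
        by (simp add: algebra_simps)
      with \<open>a < b\<close> show "\<bar>F b + k * b - (F a + k * a)\<bar> \<le> \<bar>F b - F a\<bar> + \<bar>k\<bar> * (b - a)"
        by (simp add: abs_mult)
    qed
    also have "\<dots> = (\<Sum>(c, d)\<in>D. \<bar>F d - F c\<bar>) + \<bar>k\<bar> * (\<Sum>(c, d)\<in>D. d - c)"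
      by (simp add: sum_distrib_left sum.distrib split_def)
    also have "\<dots> < e/2 + e/2"
    proof (rule add_less_le_mono)
      show "(\<Sum>(c, d)\<in>D. \<bar>F d - F c\<bar>) < e/2"
        using d D by (auto simp: d'_def)
      have "(\<Sum>(c, d)\<in>D. d - c) \<le> e / (2 * (1 + \<bar>k\<bar>))"
        using D(4) by (auto simp: d'_def)
      then have "\<bar>k\<bar> * (\<Sum>(c, d)\<in>D. d - c) \<le> \<bar>k\<bar> * (e / (2 * (1 + \<bar>k\<bar>)))"
        by (rule mult_left_mono) simp
      also have "\<dots> \<le> e/2"
        using \<open>e > 0\<close> by (simp add: field_simps)
      finally show "\<bar>k\<bar> * (\<Sum>(c, d)\<in>D. d - c) \<le> e/2" .
    qed
    finally show ?thesis by simp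
  qed
  ultimately show "\<exists>\<delta>>0. \<forall>D. finite D \<longrightarrow> (\<forall>(c, d)\<in>D. c < d \<and> c \<in> E \<and> d \<in> E) \<longrightarrow>
      pairwise (\<lambda>(c, d) (c', d'). {c<..<d} \<inter> {c'<..<d'} = {}) D \<longrightarrow>
      (\<Sum>(c, d)\<in>D. d - c) < \<delta> \<longrightarrow> (\<Sum>(c, d)\<in>D. \<bar>F d + k * d - (F c + k * c)\<bar>) < e"
    by blast
qed

lemma ACG_add_linear:
  assumes "ACG F"
  shows "ACG (\<lambda>t. F t + k * t)"
  using assms unfolding ACG_def by (auto intro!: continuous_intros AC_on_add_linear)

section \<open>Lusin's condition (N)\<close>

text \<open>A cover of \<open>Z\<close> by nonoverlapping intervals \<open>K\<close> of small total
  length is turned into the cover of the image by the intervals \<open>T K\<close> from infimum to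
  supremum of \<open>F\<close> on the part of \<open>Z\<close> in \<open>K\<close>. Each such length
  is at most twice an increment of \<open>F\<close> between two points of \<open>Z\<close> in
  \<open>K\<close>, and \<open>AC_on\<close> bounds finite sums of these increments
  uniformly.\<close>

lemma AC_on_negligible_image:
  assumes AC: "AC_on Z F" and Z: "negligible Z" "Z \<subseteq> {0..1}" and bdd: "bounded (F ` Z)"
  shows "negligible (F ` Z)"
  unfolding negligible_outer_le
proof (intro allI impI)
  fix e :: real assume "e > 0"
  then obtain \<delta> where "\<delta> > 0" and \<delta>: "\<And>D. finite D \<Longrightarrow> \<forall>(c, d)\<in>D. c < d \<and> c \<in> Z \<and> d \<in> Z \<Longrightarrow>
      pairwise (\<lambda>(c, d) (c', d'). {c<..<d} \<inter> {c'<..<d'} = {}) D \<Longrightarrow>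
      (\<Sum>(c, d)\<in>D. d - c) < \<delta> \<Longrightarrow> (\<Sum>(c, d)\<in>D. \<bar>F d - F c\<bar>) < e/2"
    using AC[unfolded AC_on_def, rule_format, of "e/2"] by auto
  have Zm: "Z \<in> lmeasurable" "measure lebesgue Z = 0"
    using Z(1) negligible_iff_measure by auto
  obtain \<D> where \<D>: "countable \<D>"
    "\<And>K. K \<in> \<D> \<Longrightarrow> K \<subseteq> cbox 0 1 \<and> K \<noteq> {} \<and> (\<exists>c d. K = cbox c d)"
    "pairwise (\<lambda>A B. interior A \<inter> interior B = {}) \<D>"
    "Z \<subseteq> \<Union>\<D>" "\<Union>\<D> \<in> lmeasurable" "measure lebesgue (\<Union>\<D>) \<le> measure lebesgue Z + \<delta>/2"
    using measurable_outer_intervals_bounded[of Z 0 1 "\<delta>/2"] Zm Z(2) \<open>\<delta> > 0\<close> by force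
  define S where "S K = F ` (Z \<inter> K)" for K
  define T where "T K = (if Z \<inter> K = {} then {} else {Inf (S K)..Sup (S K)})" for K
  have bS: "bdd_above (S K)" "bdd_below (S K)" for K
  proof -
    have "bounded (S K)" by (rule bounded_subset[OF bdd]) (auto simp: S_def)
    then show "bdd_above (S K)" "bdd_below (S K)"
      by (simp_all add: bounded_imp_bdd_above bounded_imp_bdd_below)
  qed
  have T_ge: "S K \<subseteq> T K" for K
    using bS[of K] by (cases "Z \<inter> K = {}") (auto simp: T_def intro: cInf_lower cSup_upper, auto simp: S_def)
  have *: "measure lebesgue (\<Union>K\<in>\<E>. T K) \<le> e" if \<E>: "\<E> \<subseteq> \<D>" "finite \<E>" for \<E>
  proof -
    \<comment> \<open>Only pieces with a nondegenerate \<open>T K\<close> supply pairs, as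
      \<open>AC_on\<close> asks for \<open>c < d\<close>; the others have measure zero.\<close>
    define \<E>' where "\<E>' = {K \<in> \<E>. Z \<inter> K \<noteq> {} \<and> Inf (S K) < Sup (S K)}"
    have fin: "finite \<E>'" using \<E> by (auto simp: \<E>'_def)
    have "\<exists>c d. c < d \<and> c \<in> Z \<inter> K \<and> d \<in> Z \<inter> K \<and> Sup (S K) - Inf (S K) \<le> 2 * \<bar>F d - F c\<bar>"
      if "K \<in> \<E>'" for K
    proof -
      define w where "w = Sup (S K) - Inf (S K)"
      have "w > 0" and ne: "S K \<noteq> {}" using that by (auto simp: \<E>'_def w_def S_def)
      obtain u where u: "u \<in> Z \<inter> K" "Sup (S K) - w/4 < F u"
        using less_cSup_iff[OF ne bS(1), of "Sup (S K) - w/4"] \<open>w > 0\<close> by (auto simp: S_def)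
      obtain v where v: "v \<in> Z \<inter> K" "F v < Inf (S K) + w/4"
        using cInf_less_iff[OF ne bS(2), of "Inf (S K) + w/4"] \<open>w > 0\<close> by (auto simp: S_def)
      have "F u - F v \<ge> w / 2"
        using u v by (simp add: w_def field_simps)
      then have "u \<noteq> v" "w \<le> 2 * \<bar>F u - F v\<bar>" "w \<le> 2 * \<bar>F v - F u\<bar>" using \<open>w > 0\<close> by auto
      then show ?thesis
        using u v unfolding w_def by (cases "u < v") (metis linorder_neqE_linordered_idom)+
    qed
    then obtain c d where cd: "\<And>K. K \<in> \<E>' \<Longrightarrow> c K < d K \<and> c K \<in> Z \<inter> K \<and> d K \<in> Z \<inter> K
        \<and> Sup (S K) - Inf (S K) \<le> 2 * \<bar>F (d K) - F (c K)\<bar>"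
      by metis
    have sub: "{c K<..<d K} \<subseteq> interior K" "{c K<..<d K} \<subseteq> K" if "K \<in> \<E>'" for K
    proof -
      have "K \<in> \<D>" using \<E>(1) \<open>K \<in> \<E>'\<close> by (auto simp: \<E>'_def)
      then obtain a b where "K = cbox a b" using \<D>(2) by blast
      with cd[OF that] show "{c K<..<d K} \<subseteq> interior K" "{c K<..<d K} \<subseteq> K" by auto
    qed
    have disj: "{c K<..<d K} \<inter> {c K'<..<d K'} = {}" if "K \<in> \<E>'" "K' \<in> \<E>'" "K \<noteq> K'" for K K'
    proof -
      have "interior K \<inter> interior K' = {}"
        using \<D>(3) \<E>(1) that by (auto simp: \<E>'_def pairwise_def)
      with sub that show ?thesis by blast
    qed
    \<comment> \<open>\<open>AC_on\<close> sums over a set of pairs, so different intervals must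
      give different pairs.\<close>
    have inj: "inj_on (\<lambda>K. (c K, d K)) \<E>'"
    proof (rule inj_onI, rule ccontr)
      fix K K' assume "K \<in> \<E>'" "K' \<in> \<E>'" "(c K, d K) = (c K', d K')" "K \<noteq> K'"
      then show False using disj[of K K'] cd[of K] by auto
    qed
    have "(\<Sum>K\<in>\<E>'. d K - c K) = (\<Sum>K\<in>\<E>'. measure lebesgue {c K<..<d K})"
      using cd by (intro sum.cong) (auto simp: less_imp_le)
    also have "\<dots> = measure lebesgue (\<Union>K\<in>\<E>'. {c K<..<d K})"
      by (rule measure_UNION'[symmetric]) (use fin disj in \<open>auto simp: pairwise_def disjnt_def\<close>)
    also have "\<dots> \<le> measure lebesgue (\<Union>\<D>)"
    proof (intro measure_mono_fmeasurable \<D>(5))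
      have "\<E>' \<subseteq> \<D>" using \<E>(1) by (auto simp: \<E>'_def)
      with sub(2) show "(\<Union>K\<in>\<E>'. {c K<..<d K}) \<subseteq> \<Union>\<D>" by blast
      show "(\<Union>K\<in>\<E>'. {c K<..<d K}) \<in> sets lebesgue"
        using fin by (intro sets.finite_UN) auto
    qed
    also have "\<dots> < \<delta>"
      using \<D>(6) Zm \<open>\<delta> > 0\<close> by linarith
    finally have less: "(\<Sum>K\<in>\<E>'. d K - c K) < \<delta>" .
    have F_less: "(\<Sum>K\<in>\<E>'. \<bar>F (d K) - F (c K)\<bar>) < e/2"
    proof -
      let ?D = "(\<lambda>K. (c K, d K)) ` \<E>'"
      have "(\<Sum>(c, d)\<in>?D. \<bar>F d - F c\<bar>) < e/2"
      proof (rule \<delta>)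
        show "finite ?D" using fin by simp
        show "\<forall>(c, d)\<in>?D. c < d \<and> c \<in> Z \<and> d \<in> Z" using cd by auto
        show "pairwise (\<lambda>(c, d) (c', d'). {c<..<d} \<inter> {c'<..<d'} = {}) ?D"
          unfolding pairwise_def using disj by fastforce
        show "(\<Sum>(c, d)\<in>?D. d - c) < \<delta>"
          using less by (subst sum.reindex[OF inj]) (simp add: o_def)
      qed
      then show ?thesis
        by (subst (asm) sum.reindex[OF inj]) (simp add: o_def)
    qed
    have "measure lebesgue (\<Union>K\<in>\<E>. T K) \<le> (\<Sum>K\<in>\<E>. measure lebesgue (T K))"
      by (rule measure_UNION_le) (use \<E> in \<open>auto simp: T_def\<close>)
    also have "\<dots> = (\<Sum>K\<in>\<E>'. measure lebesgue (T K))"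
      by (rule sum.mono_neutral_right) (use \<E> in \<open>auto simp: \<E>'_def T_def\<close>)
    also have "\<dots> \<le> (\<Sum>K\<in>\<E>'. 2 * \<bar>F (d K) - F (c K)\<bar>)"
      using cd by (intro sum_mono) (auto simp: \<E>'_def T_def)
    also have "\<dots> \<le> e"
      using F_less by (simp flip: sum_distrib_left)
    finally show ?thesis .
  qed
  have Tm: "T K \<in> lmeasurable" for K by (auto simp: T_def)
  show "\<exists>T. F ` Z \<subseteq> T \<and> T \<in> lmeasurable \<and> measure lebesgue T \<le> e"
  proof (intro exI conjI)
    show "F ` Z \<subseteq> (\<Union>K\<in>\<D>. T K)"
    proof
      fix y assume "y \<in> F ` Z"
      then obtain z where "z \<in> Z" "y = F z" by blast
      then obtain K where "K \<in> \<D>" "z \<in> K" using \<D>(4) by blast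
      then have "y \<in> T K" using T_ge[of K] \<open>z \<in> Z\<close> \<open>y = F z\<close> by (auto simp: S_def)
      then show "y \<in> (\<Union>K\<in>\<D>. T K)" using \<open>K \<in> \<D>\<close> by blast
    qed
    show "(\<Union>K\<in>\<D>. T K) \<in> lmeasurable"
      by (rule fmeasurable_UN_bound[where A = T and B = e, OF \<D>(1) Tm *])
    show "measure lebesgue (\<Union>K\<in>\<D>. T K) \<le> e"
      by (rule measure_UN_bound[where A = T, OF \<D>(1) Tm *])
  qed
qed

lemma ACG_negligible_image:
  assumes "ACG F" and Z: "negligible Z" "Z \<subseteq> {0..1}"
  shows "negligible (F ` Z)"
proof -
  obtain A :: "nat \<Rightarrow> real set" where A: "(\<Union>n. A n) = {0..1}" "\<And>n. AC_on (A n) F"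
    and cont: "continuous_on {0..1} F"
    using assms(1) unfolding ACG_def by auto
  have bdd: "bounded (F ` {0..1})"
    by (intro compact_imp_bounded compact_continuous_image cont) auto
  have "negligible (F ` (Z \<inter> A n))" for n
  proof (rule AC_on_negligible_image)
    show "AC_on (Z \<inter> A n) F" by (rule AC_on_subset[OF A(2)[of n]]) auto
    show "negligible (Z \<inter> A n)" using Z(1) by (simp add: negligible_Int)
    show "Z \<inter> A n \<subseteq> {0..1}" using Z by auto
    show "bounded (F ` (Z \<inter> A n))" by (rule bounded_subset[OF bdd]) (use Z in auto)
  qed
  then have "negligible (\<Union>n. F ` (Z \<inter> A n))" by (intro negligible_countable_Union) auto
  moreover have "F ` Z \<subseteq> (\<Union>n. F ` (Z \<inter> A n))" using A(1) Z(2) by blast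
  ultimately show ?thesis by (rule negligible_subset)
qed

section \<open>Approximate derivatives seen from the right\<close>

text \<open>If \<open>E\<close> missed a right neighbourhood of \<open>t\<close>, its part in
  \<open>{t - h..t + h}\<close> would lie in the left half for small \<open>h\<close>, and the
  density ratio would be at most 1/2.\<close>

lemma density_point_frequently_right:
  assumes E: "E \<in> sets lebesgue" and "density_point E t"
  shows "frequently (\<lambda>u. u \<in> E) (at_right t)"
  unfolding frequently_def
proof
  assume "eventually (\<lambda>u. u \<notin> E) (at_right t)"
  then obtain b where b: "b > t" "\<And>u. t < u \<Longrightarrow> u < b \<Longrightarrow> u \<notin> E"
    by (auto simp: eventually_at_right_field)
  have "\<forall>\<^sub>F h in at_right 0. measure lebesgue (E \<inter> {t - h..t + h}) / (2 * h) > 1/2"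
    using assms(2) unfolding density_point_def by (rule order_tendstoD) simp
  then obtain h0 where h0: "h0 > 0"
    "\<And>h. 0 < h \<Longrightarrow> h < h0 \<Longrightarrow> measure lebesgue (E \<inter> {t - h..t + h}) / (2 * h) > 1/2"
    by (auto simp: eventually_at_right_field)
  define h where "h = min h0 (b - t) / 2"
  have h: "0 < h" "h < h0" "t + h < b" using h0(1) b(1) by (auto simp: h_def min_def field_simps)
  have "E \<inter> {t - h..t + h} \<subseteq> {t - h..t}"
  proof
    fix u assume "u \<in> E \<inter> {t - h..t + h}"
    then show "u \<in> {t - h..t}" using b(2)[of u] h by (auto simp: not_less[symmetric])
  qed
  then have "measure lebesgue (E \<inter> {t - h..t + h}) \<le> measure lebesgue {t - h..t}"
    using E by (intro measure_mono_fmeasurable) auto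
  also have "\<dots> = h" using h by simp
  finally show False using h0(2)[of h] h by (simp add: field_simps)
qed

text \<open>Both limits are taken along \<open>E\<close> to the right of \<open>t\<close>, where the
  filter is nontrivial by density. This matches approximate derivatives with the right derivatives
  that differentiation of integrals produces.\<close>

lemma has_approx_derivative_right_eq:
  assumes D: "has_approx_derivative F D t"
    and r: "((\<lambda>u. (F u - F t) / (u - t)) \<longlongrightarrow> D') (at_right t)"
  shows "D = D'"
proof -
  obtain E where E: "E \<in> sets lebesgue" "density_point E t"
    "((\<lambda>u. (F u - F t) / (u - t)) \<longlongrightarrow> D) (at t within E)"
    using D unfolding has_approx_derivative_def by blast
  have "frequently (\<lambda>u. u \<in> E) (at t within {t<..})"
    by (rule density_point_frequently_right[OF E(1,2)])
  have nb: "at t within (E \<inter> {t<..}) \<noteq> bot"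
  proof
    assume "at t within (E \<inter> {t<..}) = bot"
    then have "eventually (\<lambda>u. False) (at t within (E \<inter> {t<..}))" by simp
    then have "eventually (\<lambda>u. u \<notin> E) (at t within {t<..})"
      unfolding eventually_at_filter by (rule eventually_mono) auto
    with \<open>frequently (\<lambda>u. u \<in> E) (at t within {t<..})\<close> show False
      by (simp add: frequently_def)
  qed
  show ?thesis
  proof (rule tendsto_unique[OF nb])
    show "((\<lambda>u. (F u - F t) / (u - t)) \<longlongrightarrow> D) (at t within (E \<inter> {t<..}))"
      using E(3) tendsto_within_subset by blast
    show "((\<lambda>u. (F u - F t) / (u - t)) \<longlongrightarrow> D') (at t within (E \<inter> {t<..}))"
      using r tendsto_within_subset by blast
  qed
qed

lemma has_approx_derivative_pos_right:
  assumes "has_approx_derivative F D t" "D + k > 0" "t < b"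
  shows "\<exists>u. t < u \<and> u < b \<and> F u + k * u > F t + k * t"
proof -
  obtain E where E: "E \<in> sets lebesgue" "density_point E t"
    "((\<lambda>u. (F u - F t) / (u - t)) \<longlongrightarrow> D) (at t within E)"
    using assms unfolding has_approx_derivative_def by blast
  have "\<forall>\<^sub>F u in at t within E. (F u - F t) / (u - t) > - k"
    using E(3) by (rule order_tendstoD) (use assms in auto)
  then have "\<forall>\<^sub>F u in at_right t. u \<in> E \<longrightarrow> (F u - F t) / (u - t) > - k"
    by (auto simp: eventually_at_filter elim!: eventually_mono)
  moreover have "\<forall>\<^sub>F u in at_right t. u \<in> {t<..<b}"
    using assms(3) by (rule eventually_at_right_real)
  ultimately have "\<forall>\<^sub>F u in at_right t. u \<in> E \<longrightarrow> u \<in> {t<..<b} \<and> (F u - F t) / (u - t) > - k"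
    by (rule eventually_elim2) blast
  then have "frequently (\<lambda>u. u \<in> {t<..<b} \<and> (F u - F t) / (u - t) > - k) (at_right t)"
    using density_point_frequently_right[OF E(1,2)] by (rule frequently_rev_mp[rotated])
  then obtain u where "u \<in> {t<..<b}" "(F u - F t) / (u - t) > - k"
    by (auto dest: frequently_ex)
  then show ?thesis by (intro exI[of _ u]) (auto simp: field_simps)
qed

lemma ACG_approx_derivative_nonneg_mono:
  assumes "ACG F"
    and ae: "AE t in lebesgue_on {0..1}. \<exists>D\<ge>0. has_approx_derivative F D t"
    and ab: "0 \<le> a" "a \<le> b" "b \<le> 1"
  shows "F a \<le> F b"
proof (rule ccontr)
  assume "\<not> F a \<le> F b"
  then have "a < b" "F b < F a" using ab by (auto simp: not_le) (metis less_eq_real_def order_less_irrefl)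
  \<comment> \<open>Half the mean rate of decrease: the tilt cancels only half of the drop from
    \<open>F a\<close> to \<open>F b\<close>, so \<open>G b < G a\<close> remains.\<close>
  define k where "k = (F a - F b) / (2 * (b - a))"
  have "k > 0" using \<open>a < b\<close> \<open>F b < F a\<close> by (simp add: k_def)
  define G where "G t = F t + k * t" for t
  have "k * (b - a) = (F a - F b) / 2" using \<open>a < b\<close> by (simp add: k_def divide_simps)
  then have "G b < G a" using \<open>F b < F a\<close> by (simp add: G_def algebra_simps)
  have "ACG G" unfolding G_def by (rule ACG_add_linear) fact
  then have cont: "continuous_on {a..b} G"
    using ab by (auto simp: ACG_def intro: continuous_on_subset)
  define Z where "Z = {t \<in> {0..1}. \<not> (\<exists>D\<ge>0. has_approx_derivative F D t)}"
  have "AE t in lebesgue. t \<in> {0..1} \<longrightarrow> (\<exists>D\<ge>0. has_approx_derivative F D t)"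
    using ae by (simp add: AE_restrict_space_iff)
  then have "negligible Z"
    unfolding negligible_iff_null_sets Z_def completion.AE_iff_null_sets by simp
  then have "negligible (G ` Z)"
    using \<open>ACG G\<close> by (intro ACG_negligible_image) (auto simp: Z_def)
  moreover have "{G b<..<G a} \<subseteq> G ` Z"
  proof
    fix y assume y: "y \<in> {G b<..<G a}"
    let ?S = "{t \<in> {a..b}. G t \<ge> y}"
    have "a \<in> ?S" using y \<open>a < b\<close> by auto
    then have S: "?S \<noteq> {}" "bdd_above ?S" by auto
    have "closed ?S"
      using continuous_closed_preimage[OF cont, of "{y..}"] by (simp add: vimage_def Int_def)
    \<comment> \<open>The last point at which \<open>G\<close> is at least \<open>y\<close>. To its
      right \<open>G\<close> stays below \<open>y\<close>, which a nonnegative approximate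
      derivative of \<open>F\<close> at \<open>s\<close> would contradict; so \<open>s\<close> is in
      \<open>Z\<close>, and \<open>G s = y\<close> by continuity.\<close>
    define s where "s = Sup ?S"
    have s: "s \<in> ?S" unfolding s_def using S \<open>closed ?S\<close> by (rule closed_contains_Sup)
    have "s < b" using s y by (auto simp: less_le)
    have above: "G u < y" if "s < u" "u \<le> b" for u
    proof (rule ccontr)
      assume "\<not> G u < y"
      then have "u \<le> s" unfolding s_def using that s by (intro cSup_upper S) auto
      with that show False by simp
    qed
    have "G s = y"
    proof (rule ccontr)
      assume "G s \<noteq> y"
      with s have "G s > y" by auto
      have "continuous_on {s..b} G" by (rule continuous_on_subset[OF cont]) (use s in auto)
      then obtain u where "s \<le> u" "u \<le> b" "G u = y"
        using IVT2'[of G b y s] \<open>G s > y\<close> y \<open>s < b\<close> by auto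
      then show False using above[of u] \<open>G s > y\<close> by (cases "s = u") auto
    qed
    moreover have "s \<in> Z"
    proof (rule ccontr)
      assume "s \<notin> Z"
      then obtain D where "D \<ge> 0" "has_approx_derivative F D s"
        using s ab by (auto simp: Z_def)
      from has_approx_derivative_pos_right[OF this(2), of k b] this(1) \<open>k > 0\<close> \<open>s < b\<close>
      obtain u where "s < u" "u < b" "G u > G s" by (auto simp: G_def)
      then show False using above[of u] \<open>G s = y\<close> by auto
    qed
    ultimately show "y \<in> G ` Z" by blast
  qed
  ultimately have "negligible {G b<..<G a}" by (rule negligible_subset)
  then show False using \<open>G b < G a\<close> open_not_negligible[of "{G b<..<G a}"] by auto
qed

text \<open>A Denjoy integrand comes without measurability; completeness lets it inherit
  measurability from the density of its primitive.\<close>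

lemma (in complete_measure) measurable_cong_AE:
  assumes f: "f \<in> measurable M N" and ae: "AE x in M. f x = g x" and g: "g \<in> space M \<rightarrow> space N"
  shows "g \<in> measurable M N"
proof (rule measurableI)
  fix B assume B: "B \<in> sets N"
  show "g -` B \<inter> space M \<in> sets M"
  proof (rule in_sets_AE)
    show "f -` B \<inter> space M \<in> sets M" using f B by (rule measurable_sets)
    show "AE x in M. x \<in> f -` B \<inter> space M \<longleftrightarrow> x \<in> g -` B \<inter> space M"
      using ae by eventually_elim auto
  qed auto
qed (use g in auto)

section \<open>Stieltjes measures of monotone functions with condition (N)\<close>

text \<open>The mass of the preimage of an interval \<open>K\<close> is at most the length of
  \<open>K\<close>: the preimage in \<open>{0..1}\<close> is compact, lies between its least point
  \<open>p\<close> and greatest point \<open>q\<close>, and \<open>G p\<close>, \<open>G q\<close>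
  both belong to \<open>K\<close>. Preimages of a cover of the image of \<open>Z\<close> therefore
  cover \<open>Z\<close> with mass at most the total length.\<close>

lemma emeasure_interval_measure_eq_0_if_negligible_image:
  fixes G :: "real \<Rightarrow> real"
  assumes mono: "\<And>x y. x \<le> y \<Longrightarrow> G x \<le> G y" and cont: "continuous_on UNIV G"
    and Z: "Z \<in> sets borel" "Z \<subseteq> {0..1}" and neg: "negligible (G ` Z)"
  shows "emeasure (interval_measure G) Z = 0"
proof -
  let ?\<mu> = "interval_measure G"
  have finI: "emeasure ?\<mu> {0..1} < \<infinity>"
    by (subst emeasure_interval_measure_Icc) (use mono cont in auto)
  have "measure ?\<mu> Z \<le> e" if "e > 0" for e :: real
  proof -
    have GZ: "G ` Z \<in> lmeasurable" "measure lebesgue (G ` Z) = 0"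
      using neg negligible_iff_measure by auto
    have GZ_sub: "G ` Z \<subseteq> cbox (G 0) (G 1)" using Z(2) mono by auto
    obtain \<D> where \<D>: "countable \<D>"
      "\<And>K. K \<in> \<D> \<Longrightarrow> K \<subseteq> cbox (G 0) (G 1) \<and> K \<noteq> {} \<and> (\<exists>c d. K = cbox c d)"
      "pairwise (\<lambda>A B. interior A \<inter> interior B = {}) \<D>"
      "G ` Z \<subseteq> \<Union>\<D>" "\<Union>\<D> \<in> lmeasurable" "measure lebesgue (\<Union>\<D>) \<le> measure lebesgue (G ` Z) + e"
      by (rule measurable_outer_intervals_bounded[OF GZ(1) GZ_sub \<open>e > 0\<close>]) blast
    define P where "P K = {x \<in> {0..1}. G x \<in> K}" for K
    have P: "compact (P K) \<and> measure ?\<mu> (P K) \<le> measure lebesgue K" if K: "K \<in> \<D>" for K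
    proof (cases "P K = {}")
      case False
      obtain c d where cd: "K = {c..d}" using \<D>(2)[OF K] by auto
      have "closed (P K)"
        using continuous_closed_preimage[OF continuous_on_subset[OF cont], of "{0..1}" K]
        by (simp add: P_def cd vimage_def Int_def)
      moreover have "bounded (P K)" by (rule bounded_subset[of "{0..1}"]) (auto simp: P_def)
      ultimately have cP: "compact (P K)" by (simp add: compact_eq_bounded_closed)
      obtain p where p: "p \<in> P K" "\<And>x. x \<in> P K \<Longrightarrow> p \<le> x"
        using compact_attains_inf[OF cP False] by blast
      obtain q where q: "q \<in> P K" "\<And>x. x \<in> P K \<Longrightarrow> x \<le> q"
        using compact_attains_sup[OF cP False] by blast
      have "p \<le> q" using p q by auto
      have "emeasure ?\<mu> {p..q} = G q - G p"
        by (rule emeasure_interval_measure_Icc) (use \<open>p \<le> q\<close> mono cont in auto)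
      then have m: "emeasure ?\<mu> {p..q} = ennreal (G q - G p)" by simp
      have "measure ?\<mu> (P K) \<le> measure ?\<mu> {p..q}"
        by (rule measure_mono_fmeasurable)
          (use p q \<open>compact (P K)\<close> m in \<open>auto simp: compact_imp_closed intro!: fmeasurableI\<close>)
      also have "\<dots> = G q - G p" using m mono[OF \<open>p \<le> q\<close>] by (simp add: measure_def)
      also have "\<dots> \<le> d - c" using p(1) q(1) by (auto simp: P_def cd)
      also have "\<dots> = measure lebesgue K" using p(1) by (auto simp: cd P_def)
      finally show ?thesis using cP by simp
    qed simp
    have PM: "P K \<in> fmeasurable ?\<mu>" if "K \<in> \<D>" for K
    proof (rule fmeasurableI)
      show "P K \<in> sets ?\<mu>" using P[OF that] by (auto intro: borel_closed compact_imp_closed)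
      have "emeasure ?\<mu> (P K) \<le> emeasure ?\<mu> {0..1}"
        by (rule emeasure_mono) (auto simp: P_def)
      with finI show "emeasure ?\<mu> (P K) < \<infinity>" by (rule le_less_trans[rotated])
    qed
    have *: "measure ?\<mu> (\<Union>K\<in>\<E>. P K) \<le> e" if \<E>: "\<E> \<subseteq> \<D>" "finite \<E>" for \<E>
    proof -
      have "measure ?\<mu> (\<Union>K\<in>\<E>. P K) \<le> (\<Sum>K\<in>\<E>. measure ?\<mu> (P K))"
        by (rule measure_UNION_le) (use \<E> PM fmeasurableD in blast)+
      also have "\<dots> \<le> (\<Sum>K\<in>\<E>. measure lebesgue K)"
        by (rule sum_mono) (use P \<E> in auto)
      also have "\<dots> = measure lebesgue (\<Union>\<E>)"
      proof (rule measure_negligible_finite_Union[symmetric])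
        show "finite \<E>" by fact
        show "K \<in> lmeasurable" if "K \<in> \<E>" for K
          using \<D>(2)[of K] that \<E>(1) by auto
        show "pairwise (\<lambda>S T. negligible (S \<inter> T)) \<E>"
        proof (rule pairwiseI)
          fix S T assume ST: "S \<in> \<E>" "T \<in> \<E>" "S \<noteq> T"
          then have "S \<in> \<D>" "T \<in> \<D>" using \<E> by auto
          then obtain a b c d where *: "S = cbox a b" "T = cbox c d" using \<D>(2) by metis
          have "interior (S \<inter> T) = {}"
            using \<D>(3) ST \<open>S \<in> \<D>\<close> \<open>T \<in> \<D>\<close> by (auto simp: pairwise_def)
          then show "negligible (S \<inter> T)"
            by (simp add: * negligible_convex_interior convex_Int)
        qed
      qed
      also have "\<dots> \<le> measure lebesgue (\<Union>\<D>)"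
      proof (rule measure_mono_fmeasurable)
        show "\<Union>\<E> \<in> sets lebesgue"
        proof (rule sets.finite_Union)
          show "\<E> \<subseteq> sets lebesgue"
          proof
            fix K assume "K \<in> \<E>"
            with \<D>(2) \<E>(1) obtain c d where "K = cbox c d" by blast
            then show "K \<in> sets lebesgue" by auto
          qed
        qed (use \<E> in auto)
      qed (use \<E> \<D>(5) in auto)
      also have "\<dots> \<le> e" using \<D>(6) GZ by simp
      finally show ?thesis .
    qed
    have "measure ?\<mu> Z \<le> measure ?\<mu> (\<Union>K\<in>\<D>. P K)"
    proof (rule measure_mono_fmeasurable)
      show "Z \<subseteq> (\<Union>K\<in>\<D>. P K)"
      proof
        fix z assume "z \<in> Z"
        then obtain K where "K \<in> \<D>" "G z \<in> K" using \<D>(4) by blast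
        then show "z \<in> (\<Union>K\<in>\<D>. P K)" using Z(2) \<open>z \<in> Z\<close> by (auto simp: P_def)
      qed
      show "Z \<in> sets ?\<mu>" using Z by simp
      show "(\<Union>K\<in>\<D>. P K) \<in> fmeasurable ?\<mu>"
        by (rule fmeasurable_UN_bound[where A = P and B = e, OF \<D>(1) PM *])
    qed
    also have "\<dots> \<le> e"
      by (rule measure_UN_bound[where A = P and B = e, OF \<D>(1) PM *])
    finally show ?thesis .
  qed
  then have "measure ?\<mu> Z \<le> 0" by (rule field_le_epsilon) simp
  then have "measure ?\<mu> Z = 0" by (simp add: measure_le_0_iff)
  \<comment> \<open>\<open>measure\<close> is 0 also on sets of infinite mass, so finiteness is
    needed to return to \<open>emeasure\<close>.\<close>
  moreover have "emeasure ?\<mu> Z \<le> emeasure ?\<mu> {0..1}" by (rule emeasure_mono) (use Z in auto)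
  with finI have "emeasure ?\<mu> Z \<noteq> \<infinity>" by auto
  ultimately show ?thesis by (simp add: emeasure_eq_ennreal_measure)
qed

lemma mono_ACG_density:
  assumes "ACG F" and mono: "\<And>a b. 0 \<le> a \<Longrightarrow> a \<le> b \<Longrightarrow> b \<le> 1 \<Longrightarrow> F a \<le> F b"
  obtains h :: "real \<Rightarrow> real" where "integrable lborel h"
    "\<And>a b. 0 \<le> a \<Longrightarrow> a \<le> b \<Longrightarrow> b \<le> 1 \<Longrightarrow> (LINT t:{a..b}|lborel. h t) = F b - F a"
proof -
  \<comment> \<open>Freezing \<open>F\<close> outside \<open>{0..1}\<close> gives a monotone
    continuous function on the whole line whose measure does not charge the outside.\<close>
  define G where "G x = F (max 0 (min 1 x))" for x
  have G_eq: "G x = F x" if "0 \<le> x" "x \<le> 1" for x using that by (simp add: G_def)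
  have monoG: "G x \<le> G y" if "x \<le> y" for x y
    unfolding G_def by (rule mono) (use that in auto)
  have "continuous_on {0..1} F" using assms(1) by (simp add: ACG_def)
  then have contG: "continuous_on UNIV G"
    unfolding G_def by (rule continuous_on_compose2) (auto intro!: continuous_intros)
  have contr: "continuous (at_right a) G" for a
    using contG by (simp add: continuous_on_eq_continuous_at continuous_at_imp_continuous_at_within)
  let ?\<mu> = "interval_measure G"
  have "absolutely_continuous (lborel :: real measure) ?\<mu>"
    unfolding absolutely_continuous_def
  proof
    fix N :: "real set" assume N: "N \<in> null_sets lborel"
    then have Nb: "N \<in> sets borel" by auto
    have neg: "negligible (N \<inter> {0..1})"
      using N by (intro negligible_Int) (auto simp: negligible_iff_null_sets null_sets_completionI)
    have "emeasure ?\<mu> (N \<inter> {0..1}) = 0"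
    proof (rule emeasure_interval_measure_eq_0_if_negligible_image[OF monoG contG])
      have "G ` (N \<inter> {0..1}) = F ` (N \<inter> {0..1})" by (rule image_cong) (auto simp: G_eq)
      then show "negligible (G ` (N \<inter> {0..1}))"
        using ACG_negligible_image[OF assms(1) neg] by simp
    qed (use Nb in auto)
    then have 1: "N \<inter> {0..1} \<in> null_sets ?\<mu>" using Nb by (intro null_setsI) auto
    have c: "{a<..b} \<in> null_sets ?\<mu>" if "a \<le> b" "G a = G b" for a b
      using that by (intro null_setsI) (auto simp: emeasure_interval_measure_Ioc[OF _ monoG contr])
    have 2: "(\<Union>n::nat. {- real n<..0} \<union> {1<..1 + real n}) \<in> null_sets ?\<mu>"
      by (intro null_sets_UN null_sets.Un c) (auto simp: G_def)
    have "N \<subseteq> N \<inter> {0..1} \<union> (\<Union>n::nat. {- real n<..0} \<union> {1<..1 + real n})"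
    proof
      fix x assume "x \<in> N"
      obtain n :: nat where "\<bar>x\<bar> < real n" using reals_Archimedean2 by blast
      then have "x \<in> {0..1} \<union> ({- real n<..0} \<union> {1<..1 + real n})" by auto
      with \<open>x \<in> N\<close> show "x \<in> N \<inter> {0..1} \<union> (\<Union>n::nat. {- real n<..0} \<union> {1<..1 + real n})" by blast
    qed
    with null_sets.Un[OF 1 2] show "N \<in> null_sets ?\<mu>"
      using Nb by (intro null_sets_subset[of _ ?\<mu> N]) auto
  qed
  then obtain g where g[measurable]: "g \<in> borel_measurable lborel" and dens: "density lborel g = ?\<mu>"
    using sigma_finite_measure.Radon_Nikodym[OF sigma_finite_lborel] by force
  have I: "(\<integral>\<^sup>+x. g x * indicator {a..b} x \<partial>lborel) = ennreal (G b - G a)" if "a \<le> b" for a b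
  proof -
    have "emeasure (density lborel g) {a..b} = ennreal (G b - G a)"
      unfolding dens using emeasure_interval_measure_Icc[OF that monoG contG] by simp
    then show ?thesis by (simp add: emeasure_density)
  qed
  \<comment> \<open>\<open>g\<close> may take the value infinity, which \<open>enn2real\<close>
    sends to 0; finite mass of \<open>{0..1}\<close> confines this to a null set.\<close>
  define h where "h x = enn2real (g x * indicator {0..1} x)" for x
  have h[measurable]: "h \<in> borel_measurable lborel" unfolding h_def by measurable
  have "AE x in lborel. g x * indicator {0..1} x \<noteq> \<infinity>"
    by (rule nn_integral_noteq_infinite) (use I[of 0 1] in auto)
  then have AEh: "AE x in lborel. ennreal (h x) = g x * indicator {0..1} x"
    by eventually_elim (simp add: h_def less_top)
  have nn: "(\<integral>\<^sup>+x. ennreal (h x * indicator {a..b} x) \<partial>lborel) = ennreal (F b - F a)"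
    if ab: "0 \<le> a" "a \<le> b" "b \<le> 1" for a b
  proof -
    have "(\<integral>\<^sup>+x. ennreal (h x * indicator {a..b} x) \<partial>lborel) = (\<integral>\<^sup>+x. g x * indicator {a..b} x \<partial>lborel)"
      by (rule nn_integral_cong_AE, use AEh in eventually_elim)
        (use ab in \<open>auto simp: indicator_def split: if_splits\<close>)
    also have "\<dots> = ennreal (F b - F a)" using I[of a b] ab by (simp add: G_eq)
    finally show ?thesis .
  qed
  have h01: "h x * indicator {0..1} x = h x" for x by (simp add: h_def indicator_def)
  have hint: "integrable lborel h"
  proof (rule integrableI_nonneg)
    show "(\<integral>\<^sup>+x. ennreal (h x) \<partial>lborel) < \<infinity>" using nn[of 0 1] by (simp add: h01)
  qed (auto simp: h_def)
  show ?thesis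
  proof
    show "integrable lborel h" by (rule hint)
    fix a b :: real assume ab: "0 \<le> a" "a \<le> b" "b \<le> 1"
    have "integrable lborel (\<lambda>x. h x * indicator {a..b} x)"
      by (rule integrable_mult_indicator[of "{a..b}" lborel h, simplified mult.commute scaleR_conv_of_real, simplified])
        (use hint in auto)
    then have "(\<integral>\<^sup>+x. ennreal (h x * indicator {a..b} x) \<partial>lborel)
        = ennreal (\<integral>x. h x * indicator {a..b} x \<partial>lborel)"
      by (rule nn_integral_eq_integral) (auto simp: h_def)
    with nn[OF ab] have "ennreal (\<integral>x. h x * indicator {a..b} x \<partial>lborel) = ennreal (F b - F a)" by simp
    then have "(\<integral>x. h x * indicator {a..b} x \<partial>lborel) = F b - F a"
      using mono[OF ab] by (subst (asm) ennreal_inj) (auto intro!: integral_nonneg_AE simp: h_def)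
    then show "(LINT t:{a..b}|lborel. h t) = F b - F a"
      by (simp add: set_lebesgue_integral_def mult.commute)
  qed
qed

section \<open>Differentiation of interval integrals and nonnegative Denjoy integrands\<close>

text \<open>Lebesgue differentiation along cubes with lower corner \<open>x\<close>, which on the
  line are the intervals \<open>{x..x + h}\<close>; hence right derivatives throughout.\<close>

lemma integral_right_derivative_AE:
  fixes d :: "real \<Rightarrow> real"
  assumes d: "integrable lebesgue d"
  shows "AE x in lebesgue. ((\<lambda>u. (LINT t:{x..u}|lebesgue. d t) / (u - x)) \<longlongrightarrow> d x) (at_right x)"
proof -
  have ai: "d absolutely_integrable_on S" if "S \<in> sets lebesgue" for S
    using d that unfolding set_integrable_def by (rule integrable_mult_indicator[rotated])
  have "d integrable_on cbox a b" for a b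
    by (rule set_lebesgue_integral_eq_integral(1)[OF ai]) auto
  then obtain N where N: "negligible N"
    "\<And>x e. x \<notin> N \<Longrightarrow> 0 < e \<Longrightarrow> \<exists>r>0. \<forall>h. 0 < h \<and> h < r \<longrightarrow>
       norm (integral (cbox x (x + h *\<^sub>R One)) d /\<^sub>R h ^ DIM(real) - d x) < e"
    using integrable_ccontinuous_explicit[of d] by blast
  have "((\<lambda>u. (LINT t:{x..u}|lebesgue. d t) / (u - x)) \<longlongrightarrow> d x) (at_right x)" if "x \<notin> N" for x
  proof (rule tendstoI)
    fix e :: real assume "e > 0"
    with N(2)[OF that] obtain r where r: "r > 0" "\<And>h. 0 < h \<Longrightarrow> h < r \<Longrightarrow>
       norm (integral (cbox x (x + h *\<^sub>R One)) d /\<^sub>R h ^ DIM(real) - d x) < e" by blast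
    have "eventually (\<lambda>u. u \<in> {x<..<x + r}) (at_right x)"
      using r(1) by (intro eventually_at_right_real) auto
    then show "eventually (\<lambda>u. dist ((LINT t:{x..u}|lebesgue. d t) / (u - x)) (d x) < e) (at_right x)"
    proof eventually_elim
      case (elim u)
      have "(LINT t:{x..u}|lebesgue. d t) = integral {x..u} d"
        by (rule set_lebesgue_integral_eq_integral(2)[OF ai]) auto
      with r(2)[of "u - x"] elim show ?case
        by (simp add: dist_norm divide_inverse mult.commute)
    qed
  qed
  moreover have "AE x in lebesgue. x \<notin> N"
    using N(1) by (simp add: negligible_iff_null_sets AE_not_in)
  ultimately show ?thesis by (auto elim: eventually_mono)
qed

lemma AE_lebesgue_on_01:
  assumes "AE x in lebesgue. 0 < x \<longrightarrow> x < 1 \<longrightarrow> P x"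
  shows "AE x in lebesgue_on {0..1::real}. P x"
proof -
  have "AE x::real in lebesgue. x \<noteq> 0 \<and> x \<noteq> 1"
    using AE_not_in[of "{0, 1::real}" lebesgue] by (auto simp: negligible_iff_null_sets[symmetric])
  with assms have "AE x in lebesgue. x \<in> {0..1} \<longrightarrow> P x"
    by eventually_elim auto
  then show ?thesis by (simp add: AE_restrict_space_iff)
qed

lemma AE_le_if_interval_integrals_le:
  fixes f g :: "real \<Rightarrow> real"
  assumes f: "set_integrable lebesgue {0..1} f" and g: "set_integrable lebesgue {0..1} g"
    and le: "\<And>a b. 0 \<le> a \<Longrightarrow> a \<le> b \<Longrightarrow> b \<le> 1 \<Longrightarrow>
      (LINT t:{a..b}|lebesgue. f t) \<le> (LINT t:{a..b}|lebesgue. g t)"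
  shows "AE t in lebesgue_on {0..1}. f t \<le> g t"
proof -
  define d where "d t = indicator {0..1} t * (g t - f t)" for t
  have d: "integrable lebesgue d"
    using set_integral_diff(1)[OF g f] by (simp add: d_def[abs_def] set_integrable_def)
  have "AE x in lebesgue. 0 < x \<longrightarrow> x < 1 \<longrightarrow> f x \<le> g x"
    using integral_right_derivative_AE[OF d]
  proof eventually_elim
    case (elim x)
    show ?case
    proof (intro impI)
      assume x: "0 < x" "x < 1"
      have "0 \<le> d x"
      proof (rule tendsto_lowerbound[OF elim])
        have "eventually (\<lambda>u. u \<in> {x<..<1}) (at_right x)"
          using x by (intro eventually_at_right_real) auto
        then show "eventually (\<lambda>u. 0 \<le> (LINT t:{x..u}|lebesgue. d t) / (u - x)) (at_right x)"
        proof eventually_elim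
          case (elim u)
          have "(LINT t:{x..u}|lebesgue. d t) = (LINT t:{x..u}|lebesgue. g t - f t)"
            by (rule set_lebesgue_integral_cong) (use x elim in \<open>auto simp: d_def\<close>)
          also have "\<dots> = (LINT t:{x..u}|lebesgue. g t) - (LINT t:{x..u}|lebesgue. f t)"
            by (rule set_integral_diff(2))
              (use x elim in \<open>auto intro: set_integrable_subset[OF g] set_integrable_subset[OF f]\<close>)
          finally show ?case using le[of x u] x elim by simp
        qed
      qed simp
      then show "f x \<le> g x" using x by (simp add: d_def)
    qed
  qed
  then show ?thesis by (rule AE_lebesgue_on_01)
qed

text \<open>\<open>f\<close> is identified with the density \<open>h\<close> of \<open>F\<close>:
  the right derivative of \<open>F\<close> is \<open>h\<close> almost everywhere and must agree with
  the approximate derivative. The second conclusion holds for every primitive \<open>F\<close>, so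
  it also settles uniqueness for the relational integral: all values it can return are the same
  Lebesgue integral.\<close>

lemma denjoy_primitive_nonneg:
  assumes F: "denjoy_primitive F f" and pos: "AE t in lebesgue_on {0..1}. 0 \<le> f t"
  shows "lebesgue_integrable f"
    and "\<And>a b. 0 \<le> a \<Longrightarrow> a \<le> b \<Longrightarrow> b \<le> 1 \<Longrightarrow>
      (LINT t:{a..b}|lebesgue. real_of_ereal (f t)) = F b - F a"
proof -
  have "ACG F" and der: "AE t in lebesgue_on {0..1}. \<exists>D. has_approx_derivative F D t \<and> f t = ereal D"
    using F by (auto simp: denjoy_primitive_def)
  have mono: "F a \<le> F b" if "0 \<le> a" "a \<le> b" "b \<le> 1" for a b
  proof (rule ACG_approx_derivative_nonneg_mono[OF \<open>ACG F\<close> _ that])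
    show "AE t in lebesgue_on {0..1}. \<exists>D\<ge>0. has_approx_derivative F D t"
      using der pos by eventually_elim auto
  qed
  obtain h :: "real \<Rightarrow> real" where h: "integrable lborel h"
    "\<And>a b. 0 \<le> a \<Longrightarrow> a \<le> b \<Longrightarrow> b \<le> 1 \<Longrightarrow> (LINT t:{a..b}|lborel. h t) = F b - F a"
    using mono_ACG_density[OF \<open>ACG F\<close> mono] by blast
  have hb: "h \<in> borel_measurable lborel" using h(1) by auto
  have hleb: "integrable lebesgue h" using h(1) hb by (simp add: integrable_completion)
  have hint: "(LINT t:{a..b}|lebesgue. h t) = F b - F a" if "0 \<le> a" "a \<le> b" "b \<le> 1" for a b
    unfolding h(2)[OF that, symmetric] set_lebesgue_integral_def
    using hb by (intro integral_completion) auto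
  have "AE x in lebesgue. 0 < x \<longrightarrow> x < 1 \<longrightarrow> ((\<lambda>u. (F u - F x) / (u - x)) \<longlongrightarrow> h x) (at_right x)"
    using integral_right_derivative_AE[OF hleb]
  proof eventually_elim
    case (elim x)
    show ?case
    proof (intro impI)
      assume x: "0 < x" "x < 1"
      have "eventually (\<lambda>u. u \<in> {x<..<1}) (at_right x)"
        using x by (intro eventually_at_right_real) auto
      then have "eventually (\<lambda>u. (LINT t:{x..u}|lebesgue. h t) / (u - x) = (F u - F x) / (u - x)) (at_right x)"
        by eventually_elim (use x hint in auto)
      with elim show "((\<lambda>u. (F u - F x) / (u - x)) \<longlongrightarrow> h x) (at_right x)"
        by (rule Lim_transform_eventually)
    qed
  qed
  from AE_lebesgue_on_01[OF this] der
  have f_eq: "AE t in lebesgue_on {0..1}. f t = ereal (h t)"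
    by eventually_elim (auto dest: has_approx_derivative_right_eq)
  interpret L: complete_measure "lebesgue_on {0..1::real}"
  proof
    fix A B :: "real set" assume "B \<subseteq> A" "A \<in> null_sets (lebesgue_on {0..1})"
    then show "B \<in> sets (lebesgue_on {0..1})"
      by (auto simp: null_sets_restrict_space sets_restrict_space_iff intro: completion.complete)
  qed
  have hM: "h \<in> borel_measurable (lebesgue_on {0..1})"
    using hleb by (intro measurable_restrict_space1) auto
  have f_meas: "f \<in> borel_measurable (lebesgue_on {0..1})"
    by (rule L.measurable_cong_AE[of "\<lambda>t. ereal (h t)"]) (use hM f_eq in \<open>auto elim: eventually_mono\<close>)
  have hi: "integrable (lebesgue_on {0..1}) h"
    using integrable_mult_indicator[OF _ hleb, of "{0..1}"] by (simp add: integrable_restrict_space)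
  have fr_meas: "(\<lambda>t. real_of_ereal (f t)) \<in> borel_measurable (lebesgue_on {0..1})"
    using f_meas by measurable
  show "lebesgue_integrable f"
    unfolding lebesgue_integrable_def
  proof (intro conjI)
    show "f \<in> borel_measurable (lebesgue_on {0..1})" by fact
    show "AE t in lebesgue_on {0..1}. \<bar>f t\<bar> \<noteq> \<infinity>" using f_eq by eventually_elim auto
    show "integrable (lebesgue_on {0..1}) (\<lambda>t. real_of_ereal (f t))"
      by (rule integrable_cong_AE_imp[OF hi fr_meas]) (use f_eq in \<open>auto elim: eventually_mono\<close>)
  qed
  fix a b :: real assume ab: "0 \<le> a" "a \<le> b" "b \<le> 1"
  have "AE t in lebesgue. t \<in> {0..1} \<longrightarrow> f t = ereal (h t)"
    using f_eq by (simp add: AE_restrict_space_iff)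
  then have ae: "AE t in lebesgue. t \<in> {a..b} \<longrightarrow> real_of_ereal (f t) = h t"
    by eventually_elim (use ab in auto)
  have "(LINT t:{a..b}|lebesgue. real_of_ereal (f t)) = (LINT t:{a..b}|lebesgue. h t)"
    unfolding set_lebesgue_integral_def
  proof (rule integral_cong_AE)
    have "integrable lebesgue (\<lambda>t. indicator {a..b} t *\<^sub>R h t)"
      using hleb by (intro integrable_mult_indicator) auto
    then show 1: "(\<lambda>t. indicator {a..b} t *\<^sub>R h t) \<in> borel_measurable lebesgue" by simp
    show 2: "AE t in lebesgue. indicator {a..b} t *\<^sub>R real_of_ereal (f t) = indicator {a..b} t *\<^sub>R h t"
      using ae by eventually_elim (auto simp: indicator_def)
    show "(\<lambda>t. indicator {a..b} t *\<^sub>R real_of_ereal (f t)) \<in> borel_measurable lebesgue"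
    proof (rule completion.measurable_cong_AE[OF 1])
      show "AE t in lebesgue. indicator {a..b} t *\<^sub>R h t = indicator {a..b} t *\<^sub>R real_of_ereal (f t)"
        using 2 by eventually_elim (rule sym)
    qed auto
  qed
  with hint[OF ab] show "(LINT t:{a..b}|lebesgue. real_of_ereal (f t)) = F b - F a" by simp
qed

section \<open>Sublinear functionals and the Hahn-Banach theorem\<close>

definition sublinear :: "('a::real_vector \<Rightarrow> real) \<Rightarrow> bool" where
  "sublinear q \<longleftrightarrow> (\<forall>x y. q (x + y) \<le> q x + q y) \<and> (\<forall>c x. 0 \<le> c \<longrightarrow> q (c *\<^sub>R x) = c * q x)"

text \<open>Homogeneity needs only one inequality: the other is the same one for
  \<open>inverse c\<close>.\<close>

lemma sublinearI:
  assumes "\<And>x y. q (x + y) \<le> q x + q y" and "\<And>c x. 0 < c \<Longrightarrow> q (c *\<^sub>R x) \<le> c * q x" and "q 0 = 0"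
  shows "sublinear q"
proof -
  have "q (c *\<^sub>R x) = c * q x" if "0 \<le> c" for c x
  proof (cases "c = 0")
    case False
    with that have "c > 0" by simp
    have "q (inverse c *\<^sub>R c *\<^sub>R x) \<le> inverse c * q (c *\<^sub>R x)"
      using \<open>c > 0\<close> by (intro assms(2)) simp
    then have "c * q x \<le> q (c *\<^sub>R x)" using \<open>c > 0\<close> by (simp add: field_simps)
    with assms(2)[OF \<open>c > 0\<close>, of x] show ?thesis by simp
  qed (simp add: assms(3))
  then show ?thesis using assms(1) by (auto simp: sublinear_def)
qed

lemma sublinear_zero: "sublinear q \<Longrightarrow> q 0 = 0"
  unfolding sublinear_def by (metis mult_zero_left order_refl scaleR_zero_left)

lemma sublinear_add: "sublinear q \<Longrightarrow> q (x + y) \<le> q x + q y"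
  by (simp add: sublinear_def)

lemma sublinear_scaleR: "sublinear q \<Longrightarrow> 0 \<le> c \<Longrightarrow> q (c *\<^sub>R x) = c * q x"
  by (simp add: sublinear_def)

lemma sublinear_minus: "sublinear q \<Longrightarrow> - q (- x) \<le> q x"
  using sublinear_add[of q x "- x"] sublinear_zero[of q] by simp

text \<open>Zorn's lemma. The infimum over a chain is finite because all members stay above
  \<open>- q (- x)\<close>, and subadditive because of any two members the smaller one serves for
  both summands.\<close>

lemma sublinear_minimal_exists:
  assumes q: "sublinear (q :: 'a::real_vector \<Rightarrow> real)"
  obtains m where "sublinear m" "\<And>x. m x \<le> q x"
    "\<And>r. sublinear r \<Longrightarrow> (\<And>x. r x \<le> m x) \<Longrightarrow> r = m"
proof -
  define S where "S = {r. sublinear r \<and> (\<forall>x. r x \<le> q x)}"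
  \<comment> \<open>Larger functions come first, so a maximal element for \<open>R\<close> is a
    minimal functional.\<close>
  define R where "R = {(s, r). r \<in> S \<and> s \<in> S \<and> (\<forall>x. r x \<le> (s x :: real))}"
  have FR: "Field R = S" by (auto simp: Field_def R_def)
  have "Partial_order R"
    unfolding partial_order_on_def preorder_on_def
    by (auto simp: FR refl_on_def trans_def antisym_def) (auto simp: R_def fun_eq_iff intro: order_trans antisym)
  moreover have "\<exists>u\<in>Field R. \<forall>r\<in>C. (r, u) \<in> R" if C: "C \<in> Chains R" for C
  proof (cases "C = {}")
    case True
    have "q \<in> S" using q by (simp add: S_def)
    with True FR show ?thesis by auto
  next
    case False
    have CS: "C \<subseteq> S" using C by (auto simp: Chains_def R_def)
    have tot: "(\<forall>x. r x \<le> s x) \<or> (\<forall>x. s x \<le> r x)" if "r \<in> C" "s \<in> C" for r s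
      using C that by (auto simp: Chains_def R_def)
    have lb: "- q (- x) \<le> r x" if "r \<in> C" for r x
    proof -
      have "sublinear r" "r (- x) \<le> q (- x)" using CS that by (auto simp: S_def)
      with sublinear_minus[of r x] show ?thesis by simp
    qed
    define u where "u x = (INF r\<in>C. r x)" for x
    have bdd: "bdd_below ((\<lambda>r. r x) ` C)" for x using lb by (intro bdd_belowI) auto
    have u_le: "u x \<le> r x" if "r \<in> C" for r x
      unfolding u_def using that bdd by (intro cINF_lower) auto
    have u_ge: "b \<le> u x" if "\<And>r. r \<in> C \<Longrightarrow> b \<le> r x" for b x
      unfolding u_def using that False by (intro cINF_greatest) auto
    have "sublinear u"
    proof (rule sublinearI)
      show "u (x + y) \<le> u x + u y" for x y
      proof -
        have "u (x + y) - r x \<le> u y" if r: "r \<in> C" for r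
        proof (rule u_ge)
          fix s assume s: "s \<in> C"
          obtain t where t: "t \<in> C" "t x \<le> r x" "t y \<le> s y"
            using tot[OF r s] r s by auto
          have "u (x + y) \<le> t (x + y)" by (rule u_le) fact
          also have "\<dots> \<le> t x + t y" using CS t(1) by (auto simp: S_def sublinear_add)
          finally show "u (x + y) - r x \<le> s y" using t by simp
        qed
        then have "u (x + y) - u y \<le> u x" by (intro u_ge) (auto simp: algebra_simps)
        then show ?thesis by simp
      qed
      show "u (c *\<^sub>R x) \<le> c * u x" if "0 < c" for c x
      proof -
        have "u (c *\<^sub>R x) / c \<le> r x" if r: "r \<in> C" for r
        proof -
          have "u (c *\<^sub>R x) \<le> r (c *\<^sub>R x)" by (rule u_le) fact
          also have "\<dots> = c * r x" using CS r \<open>0 < c\<close> by (auto simp: S_def intro!: sublinear_scaleR)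
          finally show ?thesis using \<open>0 < c\<close> by (simp add: field_simps)
        qed
        then have "u (c *\<^sub>R x) / c \<le> u x" by (rule u_ge)
        then show ?thesis using \<open>0 < c\<close> by (simp add: field_simps)
      qed
      have "r 0 = 0" if "r \<in> C" for r using CS that by (auto simp: S_def sublinear_zero)
      moreover obtain r where "r \<in> C" using False by blast
      ultimately show "u 0 = 0" using u_le[of r 0] u_ge[of 0 0] by force
    qed
    moreover have "u x \<le> q x" for x
    proof -
      obtain r where "r \<in> C" using False by blast
      then show ?thesis using u_le[of r x] CS by (auto simp: S_def intro: order_trans)
    qed
    ultimately have "u \<in> S" by (simp add: S_def)
    then show ?thesis
      unfolding FR using CS u_le by (intro bexI[of _ u]) (auto simp: R_def)
  qed
  ultimately obtain m where m: "m \<in> Field R" "\<forall>r\<in>Field R. (m, r) \<in> R \<longrightarrow> r = m"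
    using Zorns_po_lemma[of R] by blast
  show ?thesis
  proof
    show "sublinear m" "\<And>x. m x \<le> q x" using m(1) by (auto simp: FR S_def)
    fix r assume r: "sublinear r" "\<And>x. r x \<le> m x"
    have "r x \<le> q x" for x using r(2)[of x] \<open>m x \<le> q x\<close> by (rule order_trans)
    then have "r \<in> S" using r(1) by (simp add: S_def)
    then show "r = m" using m r(2) unfolding FR by (auto simp: R_def)
  qed
qed

text \<open>A minimal sublinear functional is odd, hence linear: for each \<open>v\<close> the
  functional \<open>r\<close> is sublinear and at most \<open>m\<close>, so equals \<open>m\<close>,
  and its bound at \<open>- v\<close> with \<open>t = 1\<close> reads
  \<open>m (- v) \<le> - m v\<close>.\<close>

lemma Hahn_Banach_linear_minorant:
  assumes q: "sublinear (q :: 'a::real_vector \<Rightarrow> real)"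
  obtains \<phi> where "linear \<phi>" "\<And>x. \<phi> x \<le> q x"
proof -
  obtain m where m: "sublinear m" "\<And>x. m x \<le> q x"
    and min: "\<And>r. sublinear r \<Longrightarrow> (\<And>x. r x \<le> m x) \<Longrightarrow> r = m"
    using sublinear_minimal_exists[OF q] by blast
  have neg: "m (- v) = - m v" for v
  proof -
    define r where "r x = (INF t\<in>{0..}. m (x + t *\<^sub>R v) - t * m v)" for x
    have lb: "- m (- x) \<le> m (x + t *\<^sub>R v) - t * m v" if "t \<ge> 0" for x t
    proof -
      have "m (t *\<^sub>R v) \<le> m (x + t *\<^sub>R v) + m (- x)"
        using sublinear_add[OF m(1), of "x + t *\<^sub>R v" "- x"] by simp
      then show ?thesis using sublinear_scaleR[OF m(1) that] by simp
    qed
    have bdd: "bdd_below ((\<lambda>t. m (x + t *\<^sub>R v) - t * m v) ` {0..})" for x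
      using lb by (intro bdd_belowI) auto
    have r_le: "r x \<le> m (x + t *\<^sub>R v) - t * m v" if "t \<ge> 0" for x t
      unfolding r_def using that bdd by (intro cINF_lower) auto
    have r_ge: "b \<le> r x" if "\<And>t. t \<ge> 0 \<Longrightarrow> b \<le> m (x + t *\<^sub>R v) - t * m v" for b x
      unfolding r_def using that by (intro cINF_greatest) auto
    have "sublinear r"
    proof (rule sublinearI)
      show "r (x + y) \<le> r x + r y" for x y
      proof -
        have "r (x + y) - (m (x + s *\<^sub>R v) - s * m v) \<le> r y" if s: "s \<ge> 0" for s
        proof (rule r_ge)
          fix t :: real assume t: "t \<ge> 0"
          have "r (x + y) \<le> m (x + y + (s + t) *\<^sub>R v) - (s + t) * m v"
            using s t by (intro r_le) simp
          also have "x + y + (s + t) *\<^sub>R v = (x + s *\<^sub>R v) + (y + t *\<^sub>R v)"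
            by (simp add: scaleR_add_left)
          also have "m \<dots> \<le> m (x + s *\<^sub>R v) + m (y + t *\<^sub>R v)" by (rule sublinear_add[OF m(1)])
          finally show "r (x + y) - (m (x + s *\<^sub>R v) - s * m v) \<le> m (y + t *\<^sub>R v) - t * m v"
            by (simp add: algebra_simps)
        qed
        then have "r (x + y) - r y \<le> r x" by (intro r_ge) (auto simp: algebra_simps)
        then show ?thesis by simp
      qed
      show "r (c *\<^sub>R x) \<le> c * r x" if c: "0 < c" for c x
      proof -
        have "r (c *\<^sub>R x) / c \<le> m (x + t *\<^sub>R v) - t * m v" if "t \<ge> 0" for t
        proof -
          have "r (c *\<^sub>R x) \<le> m (c *\<^sub>R x + (c * t) *\<^sub>R v) - (c * t) * m v"
            using that c by (intro r_le) simp
          also have "c *\<^sub>R x + (c * t) *\<^sub>R v = c *\<^sub>R (x + t *\<^sub>R v)" by (simp add: scaleR_add_right)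
          also have "m \<dots> = c * m (x + t *\<^sub>R v)" using c by (intro sublinear_scaleR[OF m(1)]) simp
          finally show ?thesis using c by (simp add: field_simps)
        qed
        then have "r (c *\<^sub>R x) / c \<le> r x" by (rule r_ge)
        then show ?thesis using c by (simp add: field_simps)
      qed
      have "m (0 + t *\<^sub>R v) - t * m v = 0" if "t \<ge> 0" for t
        using sublinear_scaleR[OF m(1) that] by simp
      then show "r 0 = 0" using r_le[of 0 0] r_ge[of 0 0] by force
    qed
    moreover have "r x \<le> m x" for x using r_le[of 0 x] by simp
    ultimately have "r = m" by (rule min)
    then have "m (- v) \<le> m (- v + 1 *\<^sub>R v) - 1 * m v" using r_le[of 1 "- v"] by simp
    then have "m (- v) \<le> - m v" using sublinear_zero[OF m(1)] by simp
    with sublinear_minus[OF m(1), of v] show ?thesis by simp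
  qed
  have add: "m (x + y) = m x + m y" for x y
  proof (rule antisym)
    show "m (x + y) \<le> m x + m y" by (rule sublinear_add[OF m(1)])
    have "m (- x + - y) \<le> m (- x) + m (- y)" by (rule sublinear_add[OF m(1)])
    then show "m x + m y \<le> m (x + y)" using neg[of "x + y"] neg[of x] neg[of y] by simp
  qed
  have "m (c *\<^sub>R x) = c *\<^sub>R m x" for c x
  proof (cases "c \<ge> 0")
    case True
    then show ?thesis using sublinear_scaleR[OF m(1)] by simp
  next
    case False
    then have "m ((- c) *\<^sub>R x) = (- c) * m x" by (intro sublinear_scaleR[OF m(1)]) simp
    then show ?thesis using neg[of "c *\<^sub>R x"] by simp
  qed
  with add have "linear m" by (intro linearI) auto
  with m(2) show ?thesis using that by blast
qed

lemma Hahn_Banach_bounded: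
  fixes q :: "'a::real_normed_vector \<Rightarrow> real"
  assumes q: "sublinear q" and b: "\<And>x. q x \<le> R * norm x"
  obtains \<phi> :: "'a \<Rightarrow>\<^sub>L real" where "\<And>x. blinfun_apply \<phi> x \<le> q x"
proof -
  obtain f where f: "linear f" "\<And>x. f x \<le> q x" using Hahn_Banach_linear_minorant[OF q] by blast
  have "bounded_linear f"
  proof (rule bounded_linear_intro)
    show "f (x + y) = f x + f y" "f (c *\<^sub>R x) = c *\<^sub>R f x" for x y c
      using f(1) by (simp_all add: linear_add linear_cmul)
    show "norm (f x) \<le> norm x * R" for x
    proof -
      have "f x \<le> R * norm x" using f(2)[of x] b[of x] by simp
      moreover have "- f x \<le> R * norm x"
        using f(2)[of "- x"] b[of "- x"] linear_neg[OF f(1), of x] by simp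
      ultimately show ?thesis by (simp add: abs_le_iff mult.commute)
    qed
  qed
  then have "blinfun_apply (Blinfun f) = f" by (rule bounded_linear_Blinfun_apply)
  then show ?thesis using f(2) by (intro that[of "Blinfun f"]) simp
qed

text \<open>\<open>q\<close> is the largest sublinear functional that is at most the norm and at
  most \<open>- d\<close> on all \<open>c - x\<close>; it stays above \<open>- norm v\<close>
  because \<open>d\<close> bounds the distances from below. Norm at most 1 together with the full
  gap \<open>d\<close> is what the quantitative correction of minorants requires.\<close>

lemma Hahn_Banach_separation_setdist:
  fixes C :: "'a::real_normed_vector set"
  assumes C: "convex C" "C \<noteq> {}" and d: "\<And>c. c \<in> C \<Longrightarrow> d \<le> dist x c"
  obtains \<phi> :: "'a \<Rightarrow>\<^sub>L real" where "norm \<phi> \<le> 1" "\<And>c. c \<in> C \<Longrightarrow> blinfun_apply \<phi> c \<le> blinfun_apply \<phi> x - d"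
proof -
  define Q where "Q v = {norm (v - s *\<^sub>R (c - x)) - s * d | s c. s \<ge> 0 \<and> c \<in> C}" for v
  define q where "q v = Inf (Q v)" for v
  obtain c0 where c0: "c0 \<in> C" using C(2) by blast
  have lb: "- norm v \<le> norm (v - s *\<^sub>R (c - x)) - s * d" if "s \<ge> 0" "c \<in> C" for v s c
  proof -
    have "s * d \<le> s * norm (c - x)"
      using d[OF that(2)] that(1) by (intro mult_left_mono) (auto simp: dist_norm norm_minus_commute)
    also have "\<dots> = norm (s *\<^sub>R (c - x))" using that(1) by simp
    also have "\<dots> \<le> norm (v - s *\<^sub>R (c - x)) + norm v"
      by (metis add.commute norm_minus_commute norm_triangle_sub)
    finally show ?thesis by simp
  qed
  have bdd: "bdd_below (Q v)" for v using lb by (intro bdd_belowI[of _ "- norm v"]) (auto simp: Q_def)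
  have ne: "Q v \<noteq> {}" for v using c0 by (auto simp: Q_def intro: exI[of _ 0])
  have q_le: "q v \<le> norm (v - s *\<^sub>R (c - x)) - s * d" if "s \<ge> 0" "c \<in> C" for v s c
    unfolding q_def using that by (intro cInf_lower bdd) (auto simp: Q_def)
  have q_ge: "b \<le> q v" if "\<And>s c. s \<ge> 0 \<Longrightarrow> c \<in> C \<Longrightarrow> b \<le> norm (v - s *\<^sub>R (c - x)) - s * d" for b v
    unfolding q_def using that by (intro cInf_greatest ne) (auto simp: Q_def)
  have q_norm: "q v \<le> norm v" for v using q_le[of 0 c0 v] c0 by simp
  have "sublinear q"
  proof (rule sublinearI)
    show "q (v + w) \<le> q v + q w" for v w
    proof -
      have "q (v + w) - (norm (v - s *\<^sub>R (c - x)) - s * d) \<le> q w" if s: "s \<ge> 0" "c \<in> C" for s c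
      proof (rule q_ge)
        fix t c' assume t: "t \<ge> (0::real)" "c' \<in> C"
        \<comment> \<open>Convexity merges multiples of \<open>c - x\<close> and
          \<open>c' - x\<close> into one multiple with total weight \<open>s + t\<close>.\<close>
        have "\<exists>c''\<in>C. (s + t) *\<^sub>R (c'' - x) = s *\<^sub>R (c - x) + t *\<^sub>R (c' - x)"
        proof (cases "s + t = 0")
          case True
          then have "s = 0" "t = 0" using s t by auto
          then show ?thesis using s by auto
        next
          case False
          then have pos: "s + t > 0" using s t by auto
          let ?c = "(s / (s + t)) *\<^sub>R c + (t / (s + t)) *\<^sub>R c'"
          have "?c \<in> C" by (rule convexD[OF C(1)]) (use s t pos in \<open>auto simp: add_divide_distrib[symmetric]\<close>)
          moreover have "(s + t) *\<^sub>R ?c = s *\<^sub>R c + t *\<^sub>R c'"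
            using pos by (simp add: scaleR_add_right)
          then have "(s + t) *\<^sub>R (?c - x) = s *\<^sub>R (c - x) + t *\<^sub>R (c' - x)"
            by (simp add: algebra_simps)
          ultimately show ?thesis by blast
        qed
        then obtain c'' where c'': "c'' \<in> C" "(s + t) *\<^sub>R (c'' - x) = s *\<^sub>R (c - x) + t *\<^sub>R (c' - x)" by blast
        have "q (v + w) \<le> norm (v + w - (s + t) *\<^sub>R (c'' - x)) - (s + t) * d"
          using s t c'' by (intro q_le) auto
        also have "v + w - (s + t) *\<^sub>R (c'' - x) = (v - s *\<^sub>R (c - x)) + (w - t *\<^sub>R (c' - x))"
          unfolding c''(2) by simp
        also have "norm \<dots> \<le> norm (v - s *\<^sub>R (c - x)) + norm (w - t *\<^sub>R (c' - x))" by (rule norm_triangle_ineq)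
        finally show "q (v + w) - (norm (v - s *\<^sub>R (c - x)) - s * d) \<le> norm (w - t *\<^sub>R (c' - x)) - t * d"
          by (simp add: algebra_simps)
      qed
      then have "q (v + w) - q w \<le> q v" by (intro q_ge) (smt (verit))
      then show ?thesis by simp
    qed
    show "q (k *\<^sub>R v) \<le> k * q v" if k: "0 < k" for k v
    proof -
      have "q (k *\<^sub>R v) / k \<le> norm (v - s *\<^sub>R (c - x)) - s * d" if "s \<ge> 0" "c \<in> C" for s c
      proof -
        have "q (k *\<^sub>R v) \<le> norm (k *\<^sub>R v - (k * s) *\<^sub>R (c - x)) - (k * s) * d"
          using that k by (intro q_le) auto
        also have "k *\<^sub>R v - (k * s) *\<^sub>R (c - x) = k *\<^sub>R (v - s *\<^sub>R (c - x))" by (simp add: algebra_simps)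
        also have "norm \<dots> = k * norm (v - s *\<^sub>R (c - x))" using k by simp
        finally show ?thesis using k by (simp add: field_simps)
      qed
      then have "q (k *\<^sub>R v) / k \<le> q v" by (rule q_ge)
      then show ?thesis using k by (simp add: field_simps)
    qed
    have "0 \<le> q 0" by (rule q_ge) (use lb[of _ _ 0] in simp)
    with q_norm[of 0] show "q 0 = 0" by simp
  qed
  moreover have "q v \<le> 1 * norm v" for v using q_norm[of v] by simp
  ultimately obtain \<phi> :: "'a \<Rightarrow>\<^sub>L real" where \<phi>: "\<And>v. blinfun_apply \<phi> v \<le> q v"
    using Hahn_Banach_bounded by blast
  show ?thesis
  proof
    show "norm \<phi> \<le> 1"
    proof (rule norm_blinfun_bound)
      show "norm (blinfun_apply \<phi> v) \<le> 1 * norm v" for v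
        using order_trans[OF \<phi> q_norm, of v] order_trans[OF \<phi> q_norm, of "- v"]
        by (simp add: blinfun.minus_right abs_le_iff)
    qed simp
    fix c assume "c \<in> C"
    have "blinfun_apply \<phi> (c - x) \<le> q (c - x)" by (rule \<phi>)
    also have "\<dots> \<le> - d" using q_le[of 1 c "c - x"] \<open>c \<in> C\<close> by simp
    finally show "blinfun_apply \<phi> c \<le> blinfun_apply \<phi> x - d" by (simp add: blinfun.diff_right)
  qed
qed

section \<open>Lagrange multipliers for affine constraints\<close>

text \<open>Lagrange duality in the plane: if \<open>(0, m)\<close> were outside the closure of the
  convex set \<open>S\<close> of pairs (constraint value, upper bound for \<open>p\<close>), a
  separating line would yield a multiplier \<open>\<alpha> / \<beta>\<close> contradicting
  \<open>inf\<close>.\<close>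

lemma convex_affine_constraint:
  fixes p u :: "'a::real_vector \<Rightarrow> real"
  assumes K: "convex K" and p: "convex_on K p"
    and u: "\<And>x y s t. x \<in> K \<Longrightarrow> y \<in> K \<Longrightarrow> 0 \<le> s \<Longrightarrow> 0 \<le> t \<Longrightarrow> s + t = 1 \<Longrightarrow>
      u (s *\<^sub>R x + t *\<^sub>R y) = s * u x + t * u y"
    and y0: "y0 \<in> K" "u y0 = 0"
    and inf: "\<And>k \<eta>. 0 < \<eta> \<Longrightarrow> \<exists>y\<in>K. p y + k * u y \<le> m + \<eta>"
    and "0 < \<delta>"
  shows "\<exists>y\<in>K. \<bar>u y\<bar> \<le> \<delta> \<and> p y \<le> m + \<delta>"
proof -
  define S where "S = {(a, r). \<exists>y\<in>K. a = u y \<and> p y \<le> r}"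
  have "convex S"
  proof (rule convexI)
    fix v w s t assume "v \<in> S" "w \<in> S" and st: "0 \<le> s" "0 \<le> t" "s + t = (1::real)"
    then obtain a b x y where xy: "x \<in> K" "y \<in> K" "v = (u x, a)" "w = (u y, b)" "p x \<le> a" "p y \<le> b"
      by (auto simp: S_def)
    have "p (s *\<^sub>R x + t *\<^sub>R y) \<le> s * p x + t * p y"
      using p xy st by (auto simp: convex_on_def)
    also have "\<dots> \<le> s * a + t * b" using xy st by (intro add_mono mult_left_mono) auto
    finally show "s *\<^sub>R v + t *\<^sub>R w \<in> S"
      using xy st convexD[OF K, of x y s t] u[of x y s t]
      by (auto simp: S_def intro!: bexI[of _ "s *\<^sub>R x + t *\<^sub>R y"])
  qed
  have "(0, m) \<in> closure S"
  proof (rule ccontr)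
    assume "(0, m) \<notin> closure S"
    then obtain a b where ab: "inner a (0, m) < b" "\<And>x. x \<in> closure S \<Longrightarrow> b < inner a x"
      using separating_hyperplane_closed_point[of "closure S" "(0, m)"] \<open>convex S\<close>
      by (meson closed_closure convex_closure)
    obtain \<alpha> \<beta> where [simp]: "a = (\<alpha>, \<beta>)" by (cases a)
    have m: "\<beta> * m < b" using ab(1) by simp
    have S: "b < \<alpha> * u y + \<beta> * r" if "y \<in> K" "p y \<le> r" for y r
      using ab(2)[of "(u y, r)"] closure_subset[of S] that by (auto simp: S_def)
    \<comment> \<open>The feasible point \<open>y0\<close> excludes a vertical separating line:
      \<open>S\<close> contains \<open>(0, r)\<close> for all large \<open>r\<close>.\<close>
    have "\<beta> > 0"
    proof (rule ccontr)
      assume "\<not> \<beta> > 0"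
      then have "\<beta> * max (p y0) m \<le> \<beta> * m" by (intro mult_left_mono_neg) auto
      with S[OF y0(1), of "max (p y0) m"] y0(2) m show False by simp
    qed
    then have "m < b / \<beta>" using m by (simp add: field_simps)
    then obtain y where y: "y \<in> K" "p y + (\<alpha> / \<beta>) * u y \<le> m + (b / \<beta> - m)"
      using inf[of "b / \<beta> - m" "\<alpha> / \<beta>"] by auto
    then have "\<beta> * (p y + (\<alpha> / \<beta>) * u y) \<le> \<beta> * (b / \<beta>)"
      using \<open>\<beta> > 0\<close> by (intro mult_left_mono) auto
    then have "\<alpha> * u y + \<beta> * p y \<le> b" using \<open>\<beta> > 0\<close> by (simp add: distrib_left)
    with S[of y "p y"] y(1) show False by simp
  qed
  then obtain z where z: "z \<in> S" "dist z (0, m) < \<delta>"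
    using \<open>0 < \<delta>\<close> closure_approachable by blast
  then obtain y r where y: "y \<in> K" "z = (u y, r)" "p y \<le> r" by (auto simp: S_def)
  have "dist (u y) 0 < \<delta>" "dist r m < \<delta>"
    using dist_fst_le[of z "(0, m)"] dist_snd_le[of z "(0, m)"] z y by auto
  then show ?thesis using y by (intro bexI[of _ y]) (auto simp: dist_real_def)
qed

text \<open>One constraint at a time: it becomes part of the domain \<open>K1\<close>, with half the
  tolerance, and the induction hypothesis handles the rest. Points of \<open>K1\<close> come from
  the one-constraint lemma, which can meet a slab of positive width but not the exact
  equation.\<close>

lemma convex_affine_constraints:
  fixes p :: "'a::real_vector \<Rightarrow> real" and u :: "'i \<Rightarrow> 'a \<Rightarrow> real"
  assumes "finite F" and K: "convex K" and p: "convex_on K p"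
    and u: "\<And>i x y s t. i \<in> F \<Longrightarrow> x \<in> K \<Longrightarrow> y \<in> K \<Longrightarrow> 0 \<le> s \<Longrightarrow> 0 \<le> t \<Longrightarrow> s + t = 1 \<Longrightarrow>
      u i (s *\<^sub>R x + t *\<^sub>R y) = s * u i x + t * u i y"
    and y0: "y0 \<in> K" "\<And>i. i \<in> F \<Longrightarrow> u i y0 = 0"
    and inf: "\<And>k \<eta>. 0 < \<eta> \<Longrightarrow> \<exists>y\<in>K. p y + (\<Sum>i\<in>F. k i * u i y) \<le> m + \<eta>"
    and "0 < \<delta>"
  shows "\<exists>y\<in>K. (\<forall>i\<in>F. \<bar>u i y\<bar> \<le> \<delta>) \<and> p y \<le> m + \<delta>"
  using assms
proof (induction F arbitrary: K m \<delta> rule: finite_induct)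
  case empty
  from empty.prems(6)[of \<delta>] empty.prems(7) show ?case by auto
next
  case (insert i F)
  note K = insert.prems(1) and p = insert.prems(2) and u = insert.prems(3) and y0 = insert.prems(4,5)
    and inf = insert.prems(6) and \<delta> = insert.prems(7)
  define K1 where "K1 = {y \<in> K. \<bar>u i y\<bar> \<le> \<delta> / 2}"
  have "\<exists>y\<in>K1. (\<forall>i\<in>F. \<bar>u i y\<bar> \<le> \<delta> / 2) \<and> p y \<le> (m + \<delta> / 2) + \<delta> / 2"
  proof (rule insert.IH)
    show "convex K1"
    proof (rule convexI)
      fix x y s t assume xy: "x \<in> K1" "y \<in> K1" and st: "0 \<le> s" "0 \<le> t" "s + t = (1::real)"
      have "\<bar>s * u i x + t * u i y\<bar> \<le> s * \<bar>u i x\<bar> + t * \<bar>u i y\<bar>"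
        using st by (intro order_trans[OF abs_triangle_ineq]) (simp add: abs_mult)
      also have "\<dots> \<le> s * (\<delta> / 2) + t * (\<delta> / 2)"
        using xy st by (intro add_mono mult_left_mono) (auto simp: K1_def)
      also have "\<dots> = \<delta> / 2" using st by (simp add: distrib_right[symmetric])
      finally have "\<bar>s * u i x + t * u i y\<bar> \<le> \<delta> / 2" .
      moreover have "u i (s *\<^sub>R x + t *\<^sub>R y) = s * u i x + t * u i y"
        by (rule u) (use xy st in \<open>auto simp: K1_def\<close>)
      moreover have "s *\<^sub>R x + t *\<^sub>R y \<in> K"
        by (rule convexD[OF K]) (use xy st in \<open>auto simp: K1_def\<close>)
      ultimately show "s *\<^sub>R x + t *\<^sub>R y \<in> K1" by (simp add: K1_def)
    qed
    show "convex_on K1 p" using p by (rule convex_on_subset) (use \<open>convex K1\<close> in \<open>auto simp: K1_def\<close>)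
    show "u j (s *\<^sub>R x + t *\<^sub>R y) = s * u j x + t * u j y"
      if "j \<in> F" "x \<in> K1" "y \<in> K1" "0 \<le> s" "0 \<le> t" "s + t = 1" for j x y s t
      by (rule u) (use that in \<open>auto simp: K1_def\<close>)
    show "y0 \<in> K1" using y0 \<delta> by (simp add: K1_def)
    show "u j y0 = 0" if "j \<in> F" for j using y0 that by simp
    show "0 < \<delta> / 2" using \<delta> by simp
    show "\<exists>y\<in>K1. p y + (\<Sum>j\<in>F. k j * u j y) \<le> m + \<delta> / 2 + \<eta>" if "0 < \<eta>" for k \<eta>
    proof -
      \<comment> \<open>The remaining multipliers are held fixed inside \<open>p'\<close>, which
        stays convex because the constraints are affine.\<close>
      define p' where "p' y = p y + (\<Sum>j\<in>F. k j * u j y)" for y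
      have "\<exists>y\<in>K. \<bar>u i y\<bar> \<le> min \<eta> (\<delta> / 2) \<and> p' y \<le> m + min \<eta> (\<delta> / 2)"
      proof (rule convex_affine_constraint)
        show "convex K" by fact
        have "p' (s *\<^sub>R x + t *\<^sub>R y) \<le> s * p' x + t * p' y"
          if "x \<in> K" "y \<in> K" "0 \<le> s" "0 \<le> t" "s + t = 1" for x y s t
        proof -
          have "(\<Sum>j\<in>F. k j * u j (s *\<^sub>R x + t *\<^sub>R y)) = (\<Sum>j\<in>F. s * (k j * u j x) + t * (k j * u j y))"
            using that by (intro sum.cong) (auto simp: u algebra_simps)
          moreover have "p (s *\<^sub>R x + t *\<^sub>R y) \<le> s * p x + t * p y"
            using p that by (auto simp: convex_on_def)
          ultimately show ?thesis
            unfolding p'_def by (simp add: sum.distrib sum_distrib_left algebra_simps)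
        qed
        then show "convex_on K p'" using K by (auto simp: convex_on_def)
        show "u i (s *\<^sub>R x + t *\<^sub>R y) = s * u i x + t * u i y"
          if "x \<in> K" "y \<in> K" "0 \<le> s" "0 \<le> t" "s + t = 1" for x y s t
          by (rule u) (use that in auto)
        show "y0 \<in> K" "u i y0 = 0" using y0 by auto
        show "\<exists>y\<in>K. p' y + l * u i y \<le> m + \<epsilon>" if "0 < \<epsilon>" for l \<epsilon>
        proof -
          obtain y where y: "y \<in> K" "p y + (\<Sum>j\<in>insert i F. (k(i := l)) j * u j y) \<le> m + \<epsilon>"
            using inf[OF \<open>0 < \<epsilon>\<close>, of "k(i := l)"] by blast
          have "(\<Sum>j\<in>insert i F. (k(i := l)) j * u j y) = l * u i y + (\<Sum>j\<in>F. k j * u j y)"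
          proof -
            have "(\<Sum>j\<in>F. (k(i := l)) j * u j y) = (\<Sum>j\<in>F. k j * u j y)"
              using insert.hyps by (intro sum.cong) auto
            then show ?thesis using insert.hyps by (subst sum.insert) auto
          qed
          with y show ?thesis by (intro bexI[of _ y]) (auto simp: p'_def)
        qed
        show "0 < min \<eta> (\<delta> / 2)" using that \<delta> by simp
      qed
      then obtain y where "y \<in> K" "\<bar>u i y\<bar> \<le> min \<eta> (\<delta> / 2)" "p' y \<le> m + min \<eta> (\<delta> / 2)" by blast
      then show ?thesis using that \<delta> by (intro bexI[of _ y]) (auto simp: K1_def p'_def)
    qed
  qed
  then obtain y where y: "y \<in> K1" "\<And>j. j \<in> F \<Longrightarrow> \<bar>u j y\<bar> \<le> \<delta> / 2" "p y \<le> m + \<delta>" by auto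
  have "\<bar>u j y\<bar> \<le> \<delta>" if "j \<in> insert i F" for j
  proof -
    have "\<bar>u j y\<bar> \<le> \<delta> / 2" using that y by (auto simp: K1_def)
    with \<delta> show ?thesis by simp
  qed
  with y show ?case by (auto simp: K1_def)
qed

section \<open>Limits along directed families of convex sets of functions\<close>

text \<open>Pointwise \<open>abs a \<le> s + a * a / s\<close> with \<open>s = (1 / 2) ^ n\<close>:
  both parts have integrals of order \<open>(1 / 2) ^ n\<close>, so the series of absolute values
  has a finite integral.\<close>

lemma (in finite_measure) AE_summable_if_L2_small:
  fixes w :: "nat \<Rightarrow> 'a \<Rightarrow> real"
  assumes w: "\<And>n. w n \<in> borel_measurable M" and i: "\<And>n. integrable M (\<lambda>x. (w n x)\<^sup>2)"
    and le: "\<And>n. (\<integral>x. (w n x)\<^sup>2 \<partial>M) \<le> B * (1 / 4) ^ n"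
  shows "AE x in M. summable (\<lambda>n. \<bar>w n x\<bar>)"
proof -
  define C where "C = measure M (space M) + B"
  have *: "(\<integral>\<^sup>+x. ennreal \<bar>w n x\<bar> \<partial>M) \<le> ennreal (C * (1 / 2) ^ n)" for n
  proof -
    define s :: real where "s = (1 / 2) ^ n"
    have s: "s > 0" "inverse s * (1 / 4) ^ n = s"
      by (simp_all add: s_def field_simps flip: power_mult_distrib power_add)
    have "\<bar>a\<bar> \<le> s + inverse s * a\<^sup>2" for a :: real
    proof -
      have "0 \<le> (\<bar>a\<bar> - s)\<^sup>2" by simp
      then have "2 * \<bar>a\<bar> * s \<le> s * s + a\<^sup>2" by (simp add: power2_eq_square algebra_simps)
      moreover have "\<bar>a\<bar> * s \<ge> 0" using s by simp
      ultimately have "\<bar>a\<bar> * s \<le> s * s + a\<^sup>2" by linarith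
      then have "inverse s * (\<bar>a\<bar> * s) \<le> inverse s * (s * s + a\<^sup>2)"
        using s(1) by (intro mult_left_mono) auto
      then show ?thesis using s(1) by (simp add: distrib_left field_simps)
    qed
    then have "(\<integral>\<^sup>+x. ennreal \<bar>w n x\<bar> \<partial>M) \<le> (\<integral>\<^sup>+x. ennreal (s + inverse s * (w n x)\<^sup>2) \<partial>M)"
      by (intro nn_integral_mono ennreal_leI)
    also have "\<dots> = ennreal (\<integral>x. s + inverse s * (w n x)\<^sup>2 \<partial>M)"
      using i[of n] s(1) by (intro nn_integral_eq_integral) auto
    finally have 1: "(\<integral>\<^sup>+x. ennreal \<bar>w n x\<bar> \<partial>M) \<le> ennreal (\<integral>x. s + inverse s * (w n x)\<^sup>2 \<partial>M)" .
    have "(\<integral>x. s + inverse s * (w n x)\<^sup>2 \<partial>M) = s * measure M (space M) + inverse s * (\<integral>x. (w n x)\<^sup>2 \<partial>M)"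
      using i[of n] by simp
    also have "\<dots> \<le> s * measure M (space M) + inverse s * (B * (1 / 4) ^ n)"
      using s(1) le[of n] by (intro add_left_mono mult_left_mono) auto
    also have "\<dots> = C * s" using s(2) by (simp add: C_def algebra_simps)
    finally show ?thesis using 1 unfolding s_def by (blast intro: order_trans ennreal_leI)
  qed
  have "0 \<le> (\<integral>x. (w 0 x)\<^sup>2 \<partial>M)" by (intro integral_nonneg_AE) auto
  also have "\<dots> \<le> B" using le[of 0] by simp
  finally have "B \<ge> 0" .
  then have C: "C \<ge> 0" by (simp add: C_def)
  have "(\<integral>\<^sup>+x. (\<Sum>n. ennreal \<bar>w n x\<bar>) \<partial>M) = (\<Sum>n. \<integral>\<^sup>+x. ennreal \<bar>w n x\<bar> \<partial>M)"
    using w by (intro nn_integral_suminf) auto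
  also have "\<dots> \<le> (\<Sum>n. ennreal (C * (1 / 2) ^ n))" by (intro suminf_le *) auto
  also have "\<dots> = ennreal (\<Sum>n. C * (1 / 2) ^ n)"
    using C by (intro suminf_ennreal2) (auto intro!: summable_mult summable_geometric)
  also have "\<dots> < \<infinity>" by simp
  finally have "(\<integral>\<^sup>+x. (\<Sum>n. ennreal \<bar>w n x\<bar>) \<partial>M) \<noteq> \<infinity>" by simp
  then have "AE x in M. (\<Sum>n. ennreal \<bar>w n x\<bar>) \<noteq> \<infinity>"
    using w by (intro nn_integral_noteq_infinite) auto
  then show ?thesis by eventually_elim (auto intro: summable_suminf_not_top)
qed

text \<open>The functional \<open>h \<mapsto> \<integral> exp (- h)\<close> is strictly convex with the explicit gap
  \<open>(exp (- a / 2) - exp (- b / 2))\<^sup>2 = exp (- a) + exp (- b) - 2 exp (- (a + b) / 2)\<close>, so its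
  near-minimisers over members far down in the family are close to each other in measure.\<close>

lemma (in finite_measure) directed_convex_AE_limit:
  fixes \<E> :: "('a \<Rightarrow> real) set set"
  assumes ne: "\<E> \<noteq> {}" "\<And>E. E \<in> \<E> \<Longrightarrow> E \<noteq> {}"
    and dir: "\<And>E E'. E \<in> \<E> \<Longrightarrow> E' \<in> \<E> \<Longrightarrow> \<exists>E''\<in>\<E>. E'' \<subseteq> E \<inter> E'"
    and mid: "\<And>E a b. E \<in> \<E> \<Longrightarrow> a \<in> E \<Longrightarrow> b \<in> E \<Longrightarrow> (\<lambda>x. (a x + b x) / 2) \<in> E"
    and int: "\<And>E h. E \<in> \<E> \<Longrightarrow> h \<in> E \<Longrightarrow> integrable M h"
    and nn: "\<And>E h. E \<in> \<E> \<Longrightarrow> h \<in> E \<Longrightarrow> AE x in M. 0 \<le> h x"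
    and bd: "\<And>E h. E \<in> \<E> \<Longrightarrow> h \<in> E \<Longrightarrow> (\<integral>x. h x \<partial>M) \<le> K"
  obtains g where "g \<in> borel_measurable M"
    "\<And>E. E \<in> \<E> \<Longrightarrow> \<exists>h. (\<forall>n::nat. h n \<in> E) \<and> (AE x in M. (\<lambda>n. h n x) \<longlonglongrightarrow> g x)"
proof -
  define \<Phi> where "\<Phi> h = (\<integral>x. exp (- h x) \<partial>M)" for h :: "'a \<Rightarrow> real"
  define I where "I E = Inf (\<Phi> ` E)" for E
  \<comment> \<open>\<open>I\<close> grows as the members shrink, so \<open>J\<close> is its limit
    along the directed family.\<close>
  define J where "J = Sup (I ` \<E>)"
  have hm: "h \<in> borel_measurable M" if "E \<in> \<E>" "h \<in> E" for E h
    using int[OF that] by auto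
  have ei: "integrable M (\<lambda>x. exp (- h x))" if "E \<in> \<E>" "h \<in> E" for E h
  proof (rule integrable_const_bound[where B = 1])
    show "AE x in M. norm (exp (- h x)) \<le> 1" using nn[OF that] by eventually_elim auto
    show "(\<lambda>x. exp (- h x)) \<in> borel_measurable M" using hm[OF that] by measurable
  qed
  have \<Phi>0: "0 \<le> \<Phi> h" for h unfolding \<Phi>_def by (intro integral_nonneg_AE) auto
  have bdb: "bdd_below (\<Phi> ` E)" for E using \<Phi>0 by (intro bdd_belowI[of _ 0]) auto
  have I_le: "I E \<le> \<Phi> h" if "E \<in> \<E>" "h \<in> E" for E h
    unfolding I_def using that bdb by (intro cINF_lower) auto
  have I_bd: "I E \<le> measure M (space M)" if E: "E \<in> \<E>" for E
  proof -
    obtain h where h: "h \<in> E" using ne(2)[OF E] by blast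
    have "\<Phi> h \<le> (\<integral>x. 1 \<partial>M)" unfolding \<Phi>_def
    proof (rule integral_mono_AE)
      show "AE x in M. exp (- h x) \<le> 1" using nn[OF E h] by eventually_elim auto
    qed (use ei[OF E h] in auto)
    with I_le[OF E h] show ?thesis by simp
  qed
  have bda: "bdd_above (I ` \<E>)" using I_bd by (intro bdd_aboveI[of _ "measure M (space M)"]) auto
  have I_J: "I E \<le> J" if "E \<in> \<E>" for E
    unfolding J_def using that bda by (intro cSUP_upper) auto
  have I_mono: "I E \<le> I E'" if "E \<in> \<E>" "E' \<in> \<E>" "E' \<subseteq> E" for E E'
    unfolding I_def using that ne(2) bdb by (intro cInf_superset_mono) auto
  define \<epsilon> :: "nat \<Rightarrow> real" where "\<epsilon> n = (1 / 4) ^ n" for n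
  have \<epsilon>: "\<epsilon> n > 0" "\<epsilon> (Suc n) \<le> \<epsilon> n" for n by (simp_all add: \<epsilon>_def)
  have ex_J: "\<exists>E'\<in>\<E>. E' \<subseteq> E \<and> J - \<epsilon> n < I E'" if E: "E \<in> \<E>" for E n
  proof -
    have "J - \<epsilon> n < Sup (I ` \<E>)" using \<epsilon>(1)[of n] by (simp add: J_def)
    then obtain E0 where E0: "E0 \<in> \<E>" "J - \<epsilon> n < I E0"
      using ne(1) bda by (auto simp: less_cSup_iff)
    obtain E' where "E' \<in> \<E>" "E' \<subseteq> E \<inter> E0" using dir[OF E E0(1)] by blast
    then show ?thesis using I_mono[OF E0(1), of E'] E0(2) by (intro bexI[of _ E']) auto
  qed
  have "\<exists>D. \<forall>n. (D n \<in> \<E> \<and> J - \<epsilon> n < I (D n)) \<and> D (Suc n) \<subseteq> D n"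
    by (rule dependent_nat_choice) (use ne(1) ex_J in blast)+
  then obtain D where D: "\<And>n. D n \<in> \<E>" "\<And>n. J - \<epsilon> n < I (D n)" "\<And>n. D (Suc n) \<subseteq> D n" by blast
  have near: "\<exists>h\<in>E. \<Phi> h < J + \<epsilon> n" if E: "E \<in> \<E>" for E n
  proof -
    have "I E < J + \<epsilon> n" using I_J[OF E] \<epsilon>(1)[of n] by simp
    then show ?thesis unfolding I_def using ne(2)[OF E] bdb by (auto simp: cInf_less_iff)
  qed
  define W where "W a b x = exp (- a x / 2) - exp (- b x / 2)" for a b :: "'a \<Rightarrow> real" and x
  have W2: "integrable M (\<lambda>x. (W a b x)\<^sup>2) \<and> (\<integral>x. (W a b x)\<^sup>2 \<partial>M) \<le> 4 * \<epsilon> n"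
    if ab: "a \<in> D n" "b \<in> D n" "\<Phi> a < J + \<epsilon> n" "\<Phi> b < J + \<epsilon> n" for a b n
  proof -
    let ?c = "\<lambda>x. (a x + b x) / 2"
    have c: "?c \<in> D n" using D(1) ab by (intro mid)
    have eq: "(W a b x)\<^sup>2 = exp (- a x) + exp (- b x) - 2 * exp (- ?c x)" for x
      unfolding W_def power2_diff exp_double[symmetric] by (simp add: add_divide_distrib flip: exp_add)
    note i = ei[OF D(1) ab(1)] ei[OF D(1) ab(2)] ei[OF D(1) c]
    have "(\<integral>x. (W a b x)\<^sup>2 \<partial>M) = \<Phi> a + \<Phi> b - 2 * \<Phi> ?c"
      unfolding eq \<Phi>_def using i by simp
    \<comment> \<open>The midpoint lies in \<open>D n\<close>, so its value exceeds
      \<open>J - \<epsilon> n\<close>, while both ends are below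
      \<open>J + \<epsilon> n\<close>.\<close>
    also have "\<dots> \<le> 4 * \<epsilon> n" using ab I_le[OF D(1) c] D(2)[of n] by simp
    finally show ?thesis unfolding eq using i by simp
  qed
  have W_summable: "AE x in M. summable (\<lambda>n. \<bar>W (a n) (b n) x\<bar>)"
    if ab: "\<And>n. a n \<in> D n" "\<And>n. b n \<in> D n" "\<And>n. \<Phi> (a n) < J + \<epsilon> n" "\<And>n. \<Phi> (b n) < J + \<epsilon> n" for a b
  proof (rule AE_summable_if_L2_small)
    show "W (a n) (b n) \<in> borel_measurable M" for n
      unfolding W_def using hm[OF D(1) ab(1)] hm[OF D(1) ab(2)] by measurable
    show "integrable M (\<lambda>x. (W (a n) (b n) x)\<^sup>2)" for n using W2[OF ab(1-4)] by blast
    show "(\<integral>x. (W (a n) (b n) x)\<^sup>2 \<partial>M) \<le> 4 * (1 / 4) ^ n" for n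
      using W2[OF ab(1-4)] unfolding \<epsilon>_def by blast
  qed
  have "\<forall>n. \<exists>h\<in>D n. \<Phi> h < J + \<epsilon> n" using near D(1) by blast
  then obtain k where k: "\<And>n. k n \<in> D n" "\<And>n. \<Phi> (k n) < J + \<epsilon> n" by metis
  have km: "k n \<in> borel_measurable M" for n using hm[OF D(1) k(1)] .
  have k0: "AE x in M. \<forall>n. 0 \<le> k n x" using nn[OF D(1) k(1)] by (simp add: AE_all_countable)
  have kS: "AE x in M. summable (\<lambda>n. \<bar>W (k n) (k (Suc n)) x\<bar>)"
  proof (rule W_summable)
    show "k (Suc n) \<in> D n" for n using k(1)[of "Suc n"] D(3) by blast
    show "\<Phi> (k (Suc n)) < J + \<epsilon> n" for n using k(2)[of "Suc n"] \<epsilon>(2)[of n] by simp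
  qed (use k in auto)
  \<comment> \<open>Convergence of \<open>exp (- k n x / 2)\<close> allows the limit 0, that is,
    \<open>k n x\<close> tending to infinity; the uniform integral bound and Fatou's lemma exclude
    this almost everywhere.\<close>
  have fin: "AE x in M. liminf (\<lambda>n. ennreal (k n x)) \<noteq> \<infinity>"
  proof (rule nn_integral_noteq_infinite)
    have "(\<integral>\<^sup>+x. liminf (\<lambda>n. ennreal (k n x)) \<partial>M) \<le> liminf (\<lambda>n. \<integral>\<^sup>+x. ennreal (k n x) \<partial>M)"
      using km by (intro nn_integral_liminf) auto
    also have "\<dots> \<le> liminf (\<lambda>n::nat. ennreal K)"
    proof (intro Liminf_mono always_eventually allI)
      fix n
      have "(\<integral>\<^sup>+x. ennreal (k n x) \<partial>M) = ennreal (\<integral>x. k n x \<partial>M)"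
        using int[OF D(1) k(1)] nn[OF D(1) k(1)] by (rule nn_integral_eq_integral)
      also have "\<dots> \<le> ennreal K" using bd[OF D(1) k(1)] by (rule ennreal_leI)
      finally show "(\<integral>\<^sup>+x. ennreal (k n x) \<partial>M) \<le> ennreal K" .
    qed
    also have "\<dots> = ennreal K" by (simp add: Liminf_const)
    finally show "(\<integral>\<^sup>+x. liminf (\<lambda>n. ennreal (k n x)) \<partial>M) \<noteq> \<infinity>" by (auto simp: top_unique)
  qed (use km in auto)
  define g where "g x = lim (\<lambda>n. k n x)" for x
  have gm: "g \<in> borel_measurable M" unfolding g_def using km by (rule borel_measurable_lim_metric)
  have kg: "AE x in M. (\<lambda>n. k n x) \<longlonglongrightarrow> g x"
    using k0 kS fin
  proof eventually_elim
    case (elim x)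
    have "summable (\<lambda>n. W (k n) (k (Suc n)) x)" using elim(2) by (rule summable_rabs_cancel)
    then have "summable (\<lambda>n. exp (- k (Suc n) x / 2) - exp (- k n x / 2))"
      using summable_minus unfolding W_def by fastforce
    then obtain L where "(\<lambda>n. \<Sum>i<n. exp (- k (Suc i) x / 2) - exp (- k i x / 2)) \<longlonglongrightarrow> L"
      by (auto simp: summable_iff_convergent convergent_def)
    then have "(\<lambda>n. exp (- k n x / 2) - exp (- k 0 x / 2)) \<longlonglongrightarrow> L"
      unfolding sum_lessThan_telescope[where f = "\<lambda>n. exp (- k n x / 2)"] .
    then have "(\<lambda>n. exp (- k n x / 2) - exp (- k 0 x / 2) + exp (- k 0 x / 2)) \<longlonglongrightarrow> L + exp (- k 0 x / 2)"
      by (intro tendsto_add tendsto_const)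
    then obtain \<omega> where \<omega>: "(\<lambda>n. exp (- k n x / 2)) \<longlonglongrightarrow> \<omega>" by auto
    have "\<omega> \<noteq> 0"
    proof
      assume "\<omega> = 0"
      have "filterlim (\<lambda>n. k n x) at_top sequentially"
      proof -
        have "filterlim (\<lambda>n. exp (- k n x / 2)) (at_right 0) sequentially"
          using \<omega> \<open>\<omega> = 0\<close> by (intro tendsto_imp_filterlim_at_right) auto
        then have "filterlim (\<lambda>n. ln (exp (- k n x / 2))) at_bot sequentially"
          by (rule filterlim_compose[OF ln_at_0])
        then have "filterlim (\<lambda>n. - (- k n x / 2)) at_top sequentially"
          by (simp add: filterlim_uminus_at_top)
        then have "filterlim (\<lambda>n. 2 * (k n x / 2)) at_top sequentially"
          by (intro filterlim_tendsto_pos_mult_at_top[OF tendsto_const]) auto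
        then show ?thesis by simp
      qed
      then have "(\<lambda>n. ennreal (k n x)) \<longlonglongrightarrow> \<infinity>"
        by (simp add: ennreal_tendsto_top_eq_at_top)
      then have "liminf (\<lambda>n. ennreal (k n x)) = \<infinity>"
        by (intro lim_imp_Liminf) auto
      with elim(3) show False by simp
    qed
    then have "(\<lambda>n. - 2 * ln (exp (- k n x / 2))) \<longlonglongrightarrow> - 2 * ln \<omega>"
      by (intro tendsto_intros \<omega>)
    then have "(\<lambda>n. k n x) \<longlonglongrightarrow> - 2 * ln \<omega>" by simp
    then show ?case unfolding g_def by (simp add: limI)
  qed
  show ?thesis
  proof
    show "g \<in> borel_measurable M" by (rule gm)
    fix E assume E: "E \<in> \<E>"
    \<comment> \<open>Near-minimisers taken from both \<open>E\<close> and \<open>D n\<close> obey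
      the same bound against \<open>k n\<close> as any two near-minimisers in \<open>D n\<close>, so
      every \<open>E\<close> yields the same limit \<open>g\<close>.\<close>
    have "\<forall>n. \<exists>h. h \<in> E \<and> h \<in> D n \<and> \<Phi> h < J + \<epsilon> n"
    proof
      fix n
      obtain E' where "E' \<in> \<E>" "E' \<subseteq> E \<inter> D n" using dir[OF E D(1)] by blast
      with near[of E' n] show "\<exists>h. h \<in> E \<and> h \<in> D n \<and> \<Phi> h < J + \<epsilon> n" by blast
    qed
    then obtain h where "\<forall>n. h n \<in> E \<and> h n \<in> D n \<and> \<Phi> (h n) < J + \<epsilon> n"
      by (rule choice[THEN exE])
    then have h: "\<And>n. h n \<in> E" "\<And>n. h n \<in> D n" "\<And>n. \<Phi> (h n) < J + \<epsilon> n" by auto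
    have "AE x in M. summable (\<lambda>n. \<bar>W (h n) (k n) x\<bar>)"
      by (rule W_summable[where a = h and b = k, OF h(2) k(1) h(3) k(2)])
    with kg have "AE x in M. (\<lambda>n. h n x) \<longlonglongrightarrow> g x"
    proof eventually_elim
      case (elim x)
      have "(\<lambda>n. W (h n) (k n) x) \<longlonglongrightarrow> 0"
        by (rule summable_LIMSEQ_zero[OF summable_rabs_cancel[OF elim(2)]])
      moreover have "(\<lambda>n. exp (- k n x / 2)) \<longlonglongrightarrow> exp (- g x / 2)"
        by (intro tendsto_intros elim(1)) simp
      ultimately have "(\<lambda>n. W (h n) (k n) x + exp (- k n x / 2)) \<longlonglongrightarrow> 0 + exp (- g x / 2)"
        by (rule tendsto_add)
      then have "(\<lambda>n. exp (- h n x / 2)) \<longlonglongrightarrow> exp (- g x / 2)" by (simp add: W_def)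
      then have "(\<lambda>n. - 2 * ln (exp (- h n x / 2))) \<longlonglongrightarrow> - 2 * ln (exp (- g x / 2))"
        by (intro tendsto_mult tendsto_const tendsto_ln) auto
      then show ?case by simp
    qed
    with h(1) show "\<exists>h. (\<forall>n::nat. h n \<in> E) \<and> (AE x in M. (\<lambda>n. h n x) \<longlonglongrightarrow> g x)" by blast
  qed
qed

section \<open>Minorants of sublinear functionals on the dual space\<close>

lemma support_fun_le_iff: "support_fun y C \<le> ereal c \<longleftrightarrow> (\<forall>x\<in>C. blinfun_apply y x \<le> c)"
  by (simp add: support_fun_def SUP_le_iff)

lemma le_support_fun: "x \<in> C \<Longrightarrow> ereal (blinfun_apply y x) \<le> support_fun y C"
  unfolding support_fun_def by (rule SUP_upper)

lemma support_fun_add_le: "support_fun (y + z) C \<le> support_fun y C + support_fun z C"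
  unfolding support_fun_def
proof (rule SUP_least)
  fix x assume x: "x \<in> C"
  have "ereal (blinfun_apply (y + z) x) = ereal (blinfun_apply y x) + ereal (blinfun_apply z x)"
    by (simp add: blinfun.add_left)
  also have "\<dots> \<le> (SUP x\<in>C. ereal (blinfun_apply y x)) + (SUP x\<in>C. ereal (blinfun_apply z x))"
    by (intro add_mono SUP_upper x)
  finally show "ereal (blinfun_apply (y + z) x)
    \<le> (SUP x\<in>C. ereal (blinfun_apply y x)) + (SUP x\<in>C. ereal (blinfun_apply z x))" .
qed

lemma support_fun_scaleR_le: "0 < c \<Longrightarrow> support_fun (c *\<^sub>R y) C \<le> ereal c * support_fun y C"
  unfolding support_fun_def
  by (rule SUP_least)
    (auto simp: blinfun.scaleR_left simp flip: times_ereal.simps(1) intro!: ereal_mult_left_mono SUP_upper)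

lemma support_fun_zero: "C \<noteq> {} \<Longrightarrow> support_fun 0 C = 0"
  by (simp add: support_fun_def)

text \<open>A linear minorant of the sublinear functional \<open>x \<mapsto> limsup (y n x)\<close> takes the place of a
  weak-star cluster point.\<close>

lemma bounded_sequence_limit_functional:
  fixes y :: "nat \<Rightarrow> 'a::real_normed_vector \<Rightarrow>\<^sub>L real"
  assumes R: "\<And>n. norm (y n) \<le> R"
  obtains \<phi> :: "'a \<Rightarrow>\<^sub>L real"
  where "\<And>x c. eventually (\<lambda>n. blinfun_apply (y n) x \<le> c) sequentially \<Longrightarrow> blinfun_apply \<phi> x \<le> c"
proof -
  define Q where "Q x = {c. eventually (\<lambda>n. blinfun_apply (y n) x \<le> c) sequentially}" for x
  define q where "q x = Inf (Q x)" for x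
  have yn: "\<bar>blinfun_apply (y n) x\<bar> \<le> R * norm x" for n x
    using norm_blinfun[of "y n" x] mult_right_mono[OF R[of n] norm_ge_zero[of x]] by simp
  have ub: "R * norm x \<in> Q x" for x
    unfolding Q_def using yn by (auto simp: abs_le_iff intro!: always_eventually)
  have lb: "- (R * norm x) \<le> c" if "c \<in> Q x" for x c
  proof -
    have "\<exists>n. blinfun_apply (y n) x \<le> c"
      using that unfolding Q_def mem_Collect_eq by (intro eventually_happens'[OF sequentially_bot])
    then obtain n where "blinfun_apply (y n) x \<le> c" by blast
    with yn[of n x] show ?thesis by (auto simp: abs_le_iff)
  qed
  have bdd: "bdd_below (Q x)" for x using lb by (intro bdd_belowI) auto
  have q_le: "q x \<le> c" if "c \<in> Q x" for x c unfolding q_def using that bdd by (rule cInf_lower)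
  have q_ge: "b \<le> q x" if "\<And>c. c \<in> Q x \<Longrightarrow> b \<le> c" for b x
    unfolding q_def using that ub by (intro cInf_greatest) auto
  have "sublinear q"
  proof (rule sublinearI)
    show "q (v + w) \<le> q v + q w" for v w
    proof -
      have "q (v + w) - c \<le> q w" if c: "c \<in> Q v" for c
      proof (rule q_ge)
        fix d assume d: "d \<in> Q w"
        have "eventually (\<lambda>n. blinfun_apply (y n) (v + w) \<le> c + d) sequentially"
          using c d unfolding Q_def mem_Collect_eq by eventually_elim (simp add: blinfun.add_right)
        then have "q (v + w) \<le> c + d" by (intro q_le) (simp add: Q_def)
        then show "q (v + w) - c \<le> d" by simp
      qed
      then have "q (v + w) - q w \<le> q v" by (intro q_ge) (smt (verit))
      then show ?thesis by simp
    qed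
    show "q (k *\<^sub>R v) \<le> k * q v" if k: "0 < k" for k v
    proof -
      have "q (k *\<^sub>R v) / k \<le> c" if c: "c \<in> Q v" for c
      proof -
        have "eventually (\<lambda>n. blinfun_apply (y n) (k *\<^sub>R v) \<le> k * c) sequentially"
          using c k unfolding Q_def by (auto simp: blinfun.scaleR_right elim!: eventually_mono)
        then have "q (k *\<^sub>R v) \<le> k * c" by (intro q_le) (simp add: Q_def)
        then show ?thesis using k by (simp add: field_simps)
      qed
      then have "q (k *\<^sub>R v) / k \<le> q v" by (rule q_ge)
      then show ?thesis using k by (simp add: field_simps)
    qed
    show "q 0 = 0" using q_le[OF ub[of 0]] q_ge[of 0 0] lb[of _ 0] by force
  qed
  moreover have "q x \<le> R * norm x" for x by (rule q_le[OF ub])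
  ultimately obtain \<phi> :: "'a \<Rightarrow>\<^sub>L real" where \<phi>: "\<And>x. blinfun_apply \<phi> x \<le> q x"
    using Hahn_Banach_bounded by blast
  show ?thesis
  proof
    fix x c assume "eventually (\<lambda>n. blinfun_apply (y n) x \<le> c) sequentially"
    then have "q x \<le> c" by (intro q_le) (simp add: Q_def)
    with \<phi>[of x] show "blinfun_apply \<phi> x \<le> c" by simp
  qed
qed

text \<open>With \<open>e = 0\<close> this is the candidate for the set-valued integral. For
  nonnegative \<open>p\<close> and positive \<open>e\<close>, the penalty turns a bound on
  \<open>p y + e * norm y\<close> into a bound on \<open>norm y\<close>.\<close>

definition approx_minorants :: "('a::real_normed_vector \<Rightarrow>\<^sub>L real \<Rightarrow> real) \<Rightarrow> real \<Rightarrow> 'a set" where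
  "approx_minorants p e = {x. \<forall>y. blinfun_apply y x \<le> p y + e * norm y}"

lemma convex_approx_minorants: "convex (approx_minorants p e)"
proof (rule convexI)
  fix x z s t assume xz: "x \<in> approx_minorants p e" "z \<in> approx_minorants p e"
    and st: "0 \<le> s" "0 \<le> t" "s + t = (1::real)"
  have "blinfun_apply y (s *\<^sub>R x + t *\<^sub>R z) \<le> p y + e * norm y" for y
  proof -
    have "blinfun_apply y (s *\<^sub>R x + t *\<^sub>R z) = s * blinfun_apply y x + t * blinfun_apply y z"
      by (simp add: blinfun.add_right blinfun.scaleR_right)
    also have "\<dots> \<le> s * (p y + e * norm y) + t * (p y + e * norm y)"
      using xz st by (intro add_mono mult_left_mono) (auto simp: approx_minorants_def)
    also have "\<dots> = p y + e * norm y" using st by (simp add: distrib_right[symmetric])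
    finally show ?thesis .
  qed
  then show "s *\<^sub>R x + t *\<^sub>R z \<in> approx_minorants p e" by (simp add: approx_minorants_def)
qed

lemma closed_approx_minorants: "closed (approx_minorants p e)"
proof -
  have "approx_minorants p e = (\<Inter>y. {x. blinfun_apply y x \<le> p y + e * norm y})"
    by (auto simp: approx_minorants_def)
  also have "closed \<dots>"
    by (intro closed_INT ballI closed_Collect_le continuous_intros)
  finally show ?thesis .
qed

text \<open>In weak-star terms, \<open>(y0, m)\<close> lies in the closure of the epigraph of
  \<open>q\<close>. The multipliers of the constraints combine to a vector \<open>z\<close>, and the
  Lagrangian is bounded below exactly when \<open>- z\<close> is an approximate minorant, in which
  case the hypothesis on \<open>m\<close> applies at \<open>- z\<close>.\<close>

lemma finite_approximants:
  fixes p :: "('a::real_normed_vector \<Rightarrow>\<^sub>L real) \<Rightarrow> real"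
  assumes p: "sublinear p" and e: "0 < e"
    and m: "\<And>x. x \<in> approx_minorants p e \<Longrightarrow> blinfun_apply y0 x \<le> m"
    and F: "finite F" and \<delta>: "0 < \<delta>"
  shows "\<exists>y. (\<forall>x\<in>F. \<bar>blinfun_apply y x - blinfun_apply y0 x\<bar> \<le> \<delta>) \<and> p y + e * norm y \<le> m + \<delta>"
proof -
  define q where "q y = p y + e * norm y" for y
  have q_add: "q (y + z) \<le> q y + q z" for y z
    using sublinear_add[OF p, of y z] mult_left_mono[OF norm_triangle_ineq[of y z], of e] e
    by (simp add: q_def distrib_left)
  have q_scale: "q (c *\<^sub>R y) = c * q y" if "0 \<le> c" for c y
    using sublinear_scaleR[OF p that, of y] that by (simp add: q_def algebra_simps)
  have "\<exists>y\<in>UNIV. (\<forall>x\<in>F. \<bar>blinfun_apply y x - blinfun_apply y0 x\<bar> \<le> \<delta>) \<and> q y \<le> m + \<delta>"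
  proof (rule convex_affine_constraints[OF F, where u = "\<lambda>x y. blinfun_apply y x - blinfun_apply y0 x" and ?y0.0 = y0])
    show "convex_on UNIV q"
    proof (rule convex_onI)
      fix t x y assume "0 < t" "t < (1::real)"
      then show "q ((1 - t) *\<^sub>R x + t *\<^sub>R y) \<le> (1 - t) * q x + t * q y"
        using q_add[of "(1 - t) *\<^sub>R x" "t *\<^sub>R y"] q_scale[of "1 - t" x] q_scale[of t y] by simp
    qed simp
    show "\<exists>y\<in>UNIV. q y + (\<Sum>x\<in>F. k x * (blinfun_apply y x - blinfun_apply y0 x)) \<le> m + \<eta>"
      if \<eta>: "0 < \<eta>" for k \<eta>
    proof -
      define z where "z = (\<Sum>x\<in>F. k x *\<^sub>R x)"
      have sum: "(\<Sum>x\<in>F. k x * (blinfun_apply y x - blinfun_apply y0 x)) = blinfun_apply y z - blinfun_apply y0 z" for y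
        by (simp add: z_def blinfun.sum_right blinfun.scaleR_right right_diff_distrib sum_subtractf)
      show ?thesis
      proof (cases "- z \<in> approx_minorants p e")
        case True
        have "q 0 = 0" using sublinear_zero[OF p] by (simp add: q_def)
        with m[OF True] \<eta> show ?thesis
          unfolding sum by (intro bexI[of _ 0]) (auto simp: blinfun.minus_right)
      next
        case False
        then obtain y where "q y < blinfun_apply y (- z)" by (auto simp: approx_minorants_def q_def not_le)
        then have neg: "q y + blinfun_apply y z < 0" by (simp add: blinfun.minus_right)
        define a where "a = - (q y + blinfun_apply y z)"
        have "a > 0" using neg by (simp add: a_def)
        \<comment> \<open>Scaling \<open>y\<close> by \<open>c\<close> pushes the homogeneous part
          of the Lagrangian far enough below zero to absorb the constant
          \<open>m + \<eta> + blinfun_apply y0 z\<close>.\<close>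
        define c where "c = \<bar>m + \<eta> + blinfun_apply y0 z\<bar> / a"
        have c: "c \<ge> 0" using \<open>a > 0\<close> by (simp add: c_def)
        have "c * a = \<bar>m + \<eta> + blinfun_apply y0 z\<bar>" using \<open>a > 0\<close> by (simp add: c_def)
        then have "q (c *\<^sub>R y) + blinfun_apply (c *\<^sub>R y) z = - \<bar>m + \<eta> + blinfun_apply y0 z\<bar>"
          using q_scale[OF c, of y] by (simp add: a_def blinfun.scaleR_left algebra_simps)
        then show ?thesis unfolding sum by (intro bexI[of _ "c *\<^sub>R y"]) auto
      qed
    qed
    show "blinfun_apply (s *\<^sub>R x + t *\<^sub>R y) i - blinfun_apply y0 i =
        s * (blinfun_apply x i - blinfun_apply y0 i) + t * (blinfun_apply y i - blinfun_apply y0 i)"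
      if "s + t = 1" for i x y s t
    proof -
      have "blinfun_apply y0 i = s * blinfun_apply y0 i + t * blinfun_apply y0 i"
        using that by (simp add: distrib_right[symmetric])
      then show ?thesis by (simp add: blinfun.add_left blinfun.scaleR_left algebra_simps)
    qed
  qed (use \<delta> in auto)
  then show ?thesis by (auto simp: q_def)
qed

text \<open>Approximate minorants can be corrected to exact ones along a Cauchy sequence: by separation,
  each member of \<open>approx_minorants p e\<close> is within \<open>2 * e\<close> of \<open>approx_minorants p (e / 2)\<close>.\<close>

lemma exact_minorant:
  fixes p :: "('a::banach \<Rightarrow>\<^sub>L real) \<Rightarrow> real"
  assumes ne: "\<And>e. 0 < e \<Longrightarrow> approx_minorants p e \<noteq> {}"
    and sup: "\<And>e y m. 0 < e \<Longrightarrow> (\<And>x. x \<in> approx_minorants p e \<Longrightarrow> blinfun_apply y x \<le> m) \<Longrightarrow> p y \<le> m"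
    and \<eta>: "0 < \<eta>"
  shows "\<exists>x\<in>approx_minorants p 0. p y - \<eta> \<le> blinfun_apply y x"
proof -
  \<comment> \<open>The corrections add up to norm at most \<open>4 * e\<close>, costing at most
    \<open>\<eta> / 2\<close> at \<open>y\<close>; the other half is spent on choosing
    \<open>x0\<close>. The summand 1 covers \<open>y = 0\<close>.\<close>
  define e where "e = \<eta> / 8 / (norm y + 1)"
  have e: "e > 0" using \<eta> by (simp add: e_def add_nonneg_pos)
  have e8: "4 * e * norm y \<le> \<eta> / 2"
  proof -
    have "norm y + 1 > 0" by (simp add: add_nonneg_pos)
    then have "e * (norm y + 1) = \<eta> / 8" unfolding e_def by (subst nonzero_eq_divide_eq[symmetric]) auto
    then show ?thesis using e by (simp add: distrib_left)
  qed
  define \<epsilon> where "\<epsilon> n = e * (1 / 2) ^ n" for n :: nat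
  have \<epsilon>: "\<epsilon> n > 0" for n using e by (simp add: \<epsilon>_def)
  have step: "\<exists>x'. x' \<in> approx_minorants p (\<epsilon> (Suc n)) \<and> dist x x' \<le> 2 * \<epsilon> n"
    if x: "x \<in> approx_minorants p (\<epsilon> n)" for x n
  proof (rule ccontr)
    assume "\<not> ?thesis"
    then have "2 * \<epsilon> n \<le> dist x c" if "c \<in> approx_minorants p (\<epsilon> (Suc n))" for c
      using that by force
    then obtain \<phi> :: "'a \<Rightarrow>\<^sub>L real" where \<phi>: "norm \<phi> \<le> 1"
      "\<And>c. c \<in> approx_minorants p (\<epsilon> (Suc n)) \<Longrightarrow> blinfun_apply \<phi> c \<le> blinfun_apply \<phi> x - 2 * \<epsilon> n"
      using Hahn_Banach_separation_setdist[OF convex_approx_minorants ne[OF \<epsilon>]] by metis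
    \<comment> \<open>The gap \<open>2 * \<epsilon> n\<close> survives in \<open>p \<phi>\<close> by
      \<open>sup\<close>, whereas membership of \<open>x\<close> allows a discrepancy of only
      \<open>\<epsilon> n\<close> for a functional of norm at most 1.\<close>
    have "p \<phi> \<le> blinfun_apply \<phi> x - 2 * \<epsilon> n" using \<epsilon> \<phi>(2) by (rule sup)
    moreover have "blinfun_apply \<phi> x \<le> p \<phi> + \<epsilon> n * norm \<phi>" using x by (simp add: approx_minorants_def)
    moreover have "\<epsilon> n * norm \<phi> \<le> \<epsilon> n" using \<phi>(1) \<epsilon>[of n] by (simp add: mult_left_le)
    ultimately show False using \<epsilon>[of n] by simp
  qed
  have "\<exists>x\<in>approx_minorants p (\<epsilon> 0). p y - \<eta> / 2 \<le> blinfun_apply y x"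
  proof (rule ccontr)
    assume "\<not> ?thesis"
    then have "p y \<le> p y - \<eta> / 2" by (intro sup[OF \<epsilon>[of 0]]) force
    with \<eta> show False by simp
  qed
  then obtain x0 where x0: "x0 \<in> approx_minorants p (\<epsilon> 0)" "p y - \<eta> / 2 \<le> blinfun_apply y x0" by blast
  have "\<exists>X. \<forall>n. (X n \<in> approx_minorants p (\<epsilon> n) \<and> (n = 0 \<longrightarrow> X n = x0)) \<and> dist (X n) (X (Suc n)) \<le> 2 * \<epsilon> n"
    by (rule dependent_nat_choice) (use x0 step in auto)
  then obtain X where X: "\<And>n. X n \<in> approx_minorants p (\<epsilon> n)" "X 0 = x0"
    "\<And>n. dist (X n) (X (Suc n)) \<le> 2 * \<epsilon> n" by blast
  define D where "D n = X (Suc n) - X n" for n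
  have D: "norm (D n) \<le> 2 * e * (1 / 2) ^ n" for n
    using X(3)[of n] by (simp add: D_def dist_norm norm_minus_commute \<epsilon>_def)
  have geo: "(\<lambda>n. 2 * e * (1 / 2) ^ n) sums (2 * e * 2)"
    using sums_mult[OF geometric_sums[of "1 / 2 :: real"], of "2 * e"] by simp
  have sD: "summable (\<lambda>n. norm (D n))"
    by (rule summable_comparison_test'[OF sums_summable[OF geo]]) (use D in simp)
  have "norm (suminf D) \<le> (\<Sum>n. norm (D n))" by (rule summable_norm[OF sD])
  also have "\<dots> \<le> (\<Sum>n. 2 * e * (1 / 2) ^ n)" by (rule suminf_le[OF D sD sums_summable[OF geo]])
  also have "\<dots> = 4 * e" using sums_unique[OF geo] by simp
  finally have nD: "norm (suminf D) \<le> 4 * e" .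
  have "(\<lambda>n. \<Sum>i<n. D i) \<longlonglongrightarrow> suminf D"
    using summable_LIMSEQ[OF summable_norm_cancel[OF sD]] .
  then have "(\<lambda>n. X n - x0) \<longlonglongrightarrow> suminf D"
    unfolding D_def sum_lessThan_telescope[where f = X] X(2) .
  then have "(\<lambda>n. X n - x0 + x0) \<longlonglongrightarrow> suminf D + x0" by (intro tendsto_add tendsto_const)
  then have lim: "X \<longlonglongrightarrow> suminf D + x0" by simp
  show ?thesis
  proof (intro bexI)
    have "\<bar>blinfun_apply y (suminf D)\<bar> \<le> norm y * norm (suminf D)" using norm_blinfun[of y] by simp
    also have "\<dots> \<le> norm y * (4 * e)" using nD by (intro mult_left_mono) auto
    also have "\<dots> = 4 * e * norm y" by simp
    finally show "p y - \<eta> \<le> blinfun_apply y (suminf D + x0)"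
      using x0(2) e8 by (simp add: blinfun.add_right abs_le_iff)
    have "blinfun_apply z (suminf D + x0) \<le> p z + 0 * norm z" for z
    proof (rule tendsto_le)
      show "(\<lambda>n. blinfun_apply z (X n)) \<longlonglongrightarrow> blinfun_apply z (suminf D + x0)"
        by (intro tendsto_intros lim)
      have "(\<lambda>n. e * (1 / 2) ^ n) \<longlonglongrightarrow> e * 0"
        by (intro tendsto_mult tendsto_const LIMSEQ_power_zero) auto
      then show "(\<lambda>n. p z + \<epsilon> n * norm z) \<longlonglongrightarrow> p z + 0 * norm z"
        unfolding \<epsilon>_def by (intro tendsto_add tendsto_mult tendsto_const) auto
      show "eventually (\<lambda>n. blinfun_apply z (X n) \<le> p z + \<epsilon> n * norm z) sequentially"
        using X(1) by (auto simp: approx_minorants_def)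
    qed simp
    then show "suminf D + x0 \<in> approx_minorants p 0" by (simp add: approx_minorants_def)
  qed
qed

section \<open>Positive multifunctions\<close>

lemma integral_le_of_AE_limit:
  fixes h :: "nat \<Rightarrow> 'a \<Rightarrow> real"
  assumes int: "\<And>n. integrable M (h n)" and nn: "\<And>n. AE x in M. 0 \<le> h n x"
    and le: "\<And>n. (\<integral>x. h n x \<partial>M) \<le> K"
    and g: "g \<in> borel_measurable M" and lim: "AE x in M. (\<lambda>n. h n x) \<longlonglongrightarrow> g x"
  shows "integrable M g" "(\<integral>x. g x \<partial>M) \<le> K"
proof -
  have nn': "AE x in M. \<forall>n. 0 \<le> h n x" using nn by (simp add: AE_all_countable)
  have g0: "AE x in M. 0 \<le> g x"
    using lim nn' by eventually_elim (auto intro: LIMSEQ_le_const)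
  have "(\<integral>\<^sup>+x. ennreal (g x) \<partial>M) = (\<integral>\<^sup>+x. liminf (\<lambda>n. ennreal (h n x)) \<partial>M)"
  proof (rule nn_integral_cong_AE)
    show "AE x in M. ennreal (g x) = liminf (\<lambda>n. ennreal (h n x))"
      using lim
    proof eventually_elim
      case (elim x)
      then have "(\<lambda>n. ennreal (h n x)) \<longlonglongrightarrow> ennreal (g x)" by (rule tendsto_ennrealI)
      then show ?case by (intro lim_imp_Liminf[symmetric]) auto
    qed
  qed
  also have "\<dots> \<le> liminf (\<lambda>n. \<integral>\<^sup>+x. ennreal (h n x) \<partial>M)"
    using int by (intro nn_integral_liminf) auto
  also have "\<dots> \<le> liminf (\<lambda>n::nat. ennreal K)"
  proof (intro Liminf_mono always_eventually allI)
    fix n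
    have "(\<integral>\<^sup>+x. ennreal (h n x) \<partial>M) = ennreal (\<integral>x. h n x \<partial>M)"
      using int nn by (rule nn_integral_eq_integral)
    also have "\<dots> \<le> ennreal K" using le by (rule ennreal_leI)
    finally show "(\<integral>\<^sup>+x. ennreal (h n x) \<partial>M) \<le> ennreal K" .
  qed
  also have "\<dots> = ennreal K" by (simp add: Liminf_const)
  finally have *: "(\<integral>\<^sup>+x. ennreal (g x) \<partial>M) \<le> ennreal K" .
  then have "(\<integral>\<^sup>+x. ennreal (g x) \<partial>M) < \<infinity>" by (rule le_less_trans) simp
  with g g0 show i: "integrable M g" by (rule integrableI_nonneg)
  \<comment> \<open>\<open>ennreal\<close> sends negative numbers to 0, so \<open>K\<close> must be
    known nonnegative before the bound can be read in the reals.\<close>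
  have "0 \<le> (\<integral>x. h 0 x \<partial>M)" using nn by (rule integral_nonneg_AE)
  with le[of 0] have "0 \<le> K" by simp
  have "ennreal (\<integral>x. g x \<partial>M) \<le> ennreal K"
    using * nn_integral_eq_integral[OF i g0] by simp
  with \<open>0 \<le> K\<close> show "(\<integral>x. g x \<partial>M) \<le> K" by (simp add: ennreal_le_iff)
qed

lemma finite_measure_lebesgue_on_01: "finite_measure (lebesgue_on {0..1::real})"
  by (rule finite_measureI) (simp add: emeasure_restrict_space)

lemma set_integrable_lebesgue_01:
  fixes h :: "real \<Rightarrow> real"
  assumes "integrable (lebesgue_on {0..1}) h" "A \<in> sets lebesgue" "A \<subseteq> {0..1}"
  shows "set_integrable lebesgue A h"
proof -
  have "set_integrable lebesgue {0..1} h"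
    using assms(1) by (simp add: integrable_restrict_space set_integrable_def)
  then show ?thesis using assms(2,3) by (rule set_integrable_subset)
qed

lemma set_integral_mono_01:
  fixes h k :: "real \<Rightarrow> real"
  assumes "integrable (lebesgue_on {0..1}) h" "integrable (lebesgue_on {0..1}) k"
    and "AE t in lebesgue_on {0..1}. h t \<le> k t" and A: "A \<in> sets lebesgue" "A \<subseteq> {0..1}"
  shows "(LINT t:A|lebesgue. h t) \<le> (LINT t:A|lebesgue. k t)"
proof (rule set_integral_mono_AE)
  show "set_integrable lebesgue A h" "set_integrable lebesgue A k"
    using assms by (auto intro: set_integrable_lebesgue_01)
  have "AE t in lebesgue. t \<in> {0..1} \<longrightarrow> h t \<le> k t"
    using assms(3) by (simp add: AE_restrict_space_iff)
  then show "AE t\<in>A in lebesgue. h t \<le> k t"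
    by eventually_elim (use A in auto)
qed

lemma integral_lebesgue_on_01:
  fixes h :: "real \<Rightarrow> real"
  shows "(\<integral>t. h t \<partial>lebesgue_on {0..1}) = (LINT t:{0..1}|lebesgue. h t)"
  by (simp add: integral_restrict_space set_lebesgue_integral_def)

lemma set_integral_indicator_01:
  fixes h :: "real \<Rightarrow> real"
  assumes "A \<subseteq> {0..1}"
  shows "(\<integral>t. indicator A t * h t \<partial>lebesgue_on {0..1}) = (LINT t:A|lebesgue. h t)"
proof -
  have "indicator {0..1} t * (indicator A t * h t) = indicator A t * h t" for t
    using assms by (auto simp: indicator_def)
  then show ?thesis
    unfolding set_lebesgue_integral_def by (subst integral_restrict_space, simp) (simp only: real_scaleR_def)
qed

text \<open>The uniform boundedness principle for the points of \<open>N\<close> as functionals on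
  the dual, whose completeness gives Baire's theorem for the closed sets \<open>V n\<close>. A ball
  of radius \<open>r\<close> inside some \<open>V n\<close> yields the constant
  \<open>2 * real n / r\<close>.\<close>

lemma support_fun_uniformly_bounded:
  fixes N :: "'a::real_normed_vector set"
  assumes fin: "\<And>y. support_fun y N \<le> ereal (s y)"
  obtains C where "C \<ge> 0" "\<And>y. support_fun y N \<le> ereal (C * norm y)"
proof -
  define V where "V n = {y :: 'a \<Rightarrow>\<^sub>L real. \<forall>x\<in>N. \<bar>blinfun_apply y x\<bar> \<le> real n}" for n
  have "\<exists>n. y \<in> V n" for y
  proof -
    obtain n where "max (s y) (s (- y)) < real n" using reals_Archimedean2 by blast
    moreover have "blinfun_apply y x \<le> s y" "blinfun_apply (- y) x \<le> s (- y)" if "x \<in> N" for x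
      using fin that unfolding support_fun_le_iff by blast+
    ultimately have "y \<in> V n" by (force simp: V_def abs_le_iff blinfun.minus_left)
    then show ?thesis by blast
  qed
  then have V_UNIV: "\<Union>(range V) = UNIV" by auto
  have closed_V: "closed (V n)" for n
  proof -
    have "V n = (\<Inter>x\<in>N. {y. \<bar>blinfun_apply y x\<bar> \<le> real n})" by (auto simp: V_def)
    also have "closed \<dots>" by (intro closed_INT ballI closed_Collect_le continuous_intros)
    finally show ?thesis .
  qed
  have "\<exists>n. euclidean interior_of (V n) \<noteq> {}"
  proof (rule ccontr)
    assume "\<not> ?thesis"
    then have "euclidean interior_of (\<Union>(range V)) = {}"
      using closed_V by (intro Baire_category_alt) (auto simp: completely_metrizable_space_euclidean)
    moreover have "(euclidean :: ('a \<Rightarrow>\<^sub>L real) topology) interior_of UNIV = UNIV"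
      using interior_of_topspace[of "euclidean :: ('a \<Rightarrow>\<^sub>L real) topology"] by simp
    ultimately show False by (simp add: V_UNIV)
  qed
  then obtain n z T where "open T" "z \<in> T" "T \<subseteq> V n" by (auto simp: interior_of_def)
  then obtain r where r: "r > 0" "cball z r \<subseteq> V n" by (metis open_contains_cball subset_trans)
  have "blinfun_apply y x \<le> 2 * real n / r * norm y" if x: "x \<in> N" for x and y :: "'a \<Rightarrow>\<^sub>L real"
  proof (cases "y = 0")
    case False
    define w where "w = (r / norm y) *\<^sub>R y"
    have "norm w = r" using False r(1) by (simp add: w_def)
    then have "z + w \<in> V n" "z \<in> V n" using r by (auto simp: subset_iff dist_norm)
    then have "\<bar>blinfun_apply (z + w) x\<bar> \<le> real n" "\<bar>blinfun_apply z x\<bar> \<le> real n"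
      using x by (auto simp: V_def)
    then have "blinfun_apply w x \<le> 2 * real n" by (simp add: blinfun.add_left)
    then show ?thesis using False r(1) by (simp add: w_def blinfun.scaleR_left field_simps)
  qed simp
  then have "support_fun y N \<le> ereal (2 * real n / r * norm y)" for y
    unfolding support_fun_le_iff by blast
  then show ?thesis using r(1) by (intro that[of "2 * real n / r"]) auto
qed

text \<open>What Denjoy-Pettis integrability becomes once the scalar integrals are identified as
  Lebesgue integrals; the sets for intervals are kept only through their support functions.\<close>

locale positive_interval_integrable =
  fixes \<Gamma> :: "real \<Rightarrow> 'a::banach set"
  assumes nonempty: "t \<in> {0..1} \<Longrightarrow> \<Gamma> t \<noteq> {}"
    and positive: "AE t in lebesgue_on {0..1}. 0 \<le> support_fun y (\<Gamma> t)"
    and integrable_support: "lebesgue_integrable (\<lambda>t. support_fun y (\<Gamma> t))"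
    and interval: "0 \<le> a \<Longrightarrow> a \<le> b \<Longrightarrow> b \<le> 1 \<Longrightarrow> \<exists>N. \<forall>y. support_fun y N =
      ereal (LINT t:{a..b}|lebesgue. real_of_ereal (support_fun y (\<Gamma> t)))"
begin

abbreviation f :: "'a \<Rightarrow>\<^sub>L real \<Rightarrow> real \<Rightarrow> real" where
  "f y t \<equiv> real_of_ereal (support_fun y (\<Gamma> t))"

abbreviation p :: "real set \<Rightarrow> 'a \<Rightarrow>\<^sub>L real \<Rightarrow> real" where
  "p A y \<equiv> (LINT t:A|lebesgue. f y t)"

lemma f_int: "integrable (lebesgue_on {0..1}) (f y)"
  using integrable_support[of y] by (simp add: lebesgue_integrable_def)

lemma f_eq: "AE t in lebesgue_on {0..1}. support_fun y (\<Gamma> t) = ereal (f y t)"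
proof -
  have "AE t in lebesgue_on {0..1}. \<bar>support_fun y (\<Gamma> t)\<bar> \<noteq> \<infinity>"
    using integrable_support[of y] by (simp add: lebesgue_integrable_def)
  then show ?thesis by eventually_elim (simp add: ereal_real')
qed

lemma f_nonneg: "AE t in lebesgue_on {0..1}. 0 \<le> f y t"
  using positive[of y] by eventually_elim (simp add: real_of_ereal_pos)

lemma f_add: "AE t in lebesgue_on {0..1}. f (y + z) t \<le> f y t + f z t"
  using f_eq[of "y + z"] f_eq[of y] f_eq[of z]
proof eventually_elim
  case (elim t)
  then show ?case using support_fun_add_le[of y z "\<Gamma> t"] by (metis ereal_less_eq(3) plus_ereal.simps(1))
qed

lemma f_scaleR: "0 < c \<Longrightarrow> AE t in lebesgue_on {0..1}. f (c *\<^sub>R y) t \<le> c * f y t"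
  using f_eq[of "c *\<^sub>R y"] f_eq[of y]
proof eventually_elim
  case (elim t)
  then show ?case using support_fun_scaleR_le[of c y "\<Gamma> t"] by (metis ereal_less_eq(3) times_ereal.simps(1))
qed

lemma p_nonneg:
  assumes "A \<in> sets lebesgue" "A \<subseteq> {0..1}"
  shows "0 \<le> p A y"
proof -
  have "(LINT t:A|lebesgue. 0) \<le> p A y"
    by (rule set_integral_mono_01) (use f_int f_nonneg assms in auto)
  then show ?thesis by (simp add: set_lebesgue_integral_def)
qed

lemma p_sublinear:
  assumes A: "A \<in> sets lebesgue" "A \<subseteq> {0..1}"
  shows "sublinear (p A)"
proof (rule sublinearI)
  note si = set_integrable_lebesgue_01[OF f_int A]
  show "p A (y + z) \<le> p A y + p A z" for y z
  proof -
    have "p A (y + z) \<le> (LINT t:A|lebesgue. f y t + f z t)"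
      by (rule set_integral_mono_01) (use f_int f_add A in auto)
    also have "\<dots> = p A y + p A z" by (rule set_integral_add(2)[OF si si])
    finally show ?thesis .
  qed
  show "p A (c *\<^sub>R y) \<le> c * p A y" if "0 < c" for c y
  proof -
    have "p A (c *\<^sub>R y) \<le> (LINT t:A|lebesgue. c * f y t)"
      by (rule set_integral_mono_01) (use f_int f_scaleR[OF that] A in auto)
    then show ?thesis by simp
  qed
  show "p A 0 = 0"
  proof -
    have "p A 0 = (LINT t:A|lebesgue. 0)"
      using A nonempty by (intro set_lebesgue_integral_cong) (auto simp: support_fun_zero subset_iff)
    then show ?thesis by (simp add: set_lebesgue_integral_def)
  qed
qed

lemma p_mono:
  assumes A: "A \<in> sets lebesgue" "A \<subseteq> {0..1}"
  shows "p A y \<le> p {0..1} y"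
proof -
  have "p A y = (\<integral>t. indicator A t * f y t \<partial>lebesgue_on {0..1})"
    using A by (simp add: set_integral_indicator_01)
  also have "\<dots> \<le> (\<integral>t. f y t \<partial>lebesgue_on {0..1})"
  proof (rule integral_mono_AE)
    show "integrable (lebesgue_on {0..1}) (\<lambda>t. indicator A t * f y t)"
      using integrable_mult_indicator[OF _ f_int, of A y] A by (simp add: sets_restrict_space_iff)
    show "AE t in lebesgue_on {0..1}. indicator A t * f y t \<le> f y t"
      using f_nonneg[of y] by eventually_elim (auto simp: indicator_def)
  qed (rule f_int)
  finally show ?thesis by (simp add: integral_lebesgue_on_01)
qed

lemma p_bounded: "\<exists>C\<ge>0. \<forall>y. p {0..1} y \<le> C * norm y"
proof -
  obtain N where N: "\<And>y. support_fun y N = ereal (p {0..1} y)"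
    using interval[of 0 1] by auto
  then have "support_fun y N \<le> ereal (p {0..1} y)" for y by simp
  then obtain C where "C \<ge> 0" "\<And>y. support_fun y N \<le> ereal (C * norm y)"
    by (rule support_fun_uniformly_bounded) blast
  then show ?thesis by (auto simp: N)
qed

text \<open>The functionals almost agreeing with \<open>y0\<close> on finite sets and almost realising the bound
  \<open>m\<close> need not have uniformly integrable support functions, so mass can escape in the limit.
  The almost everywhere limit \<open>g\<close> does not see the escaping mass, and since every \<open>\<Gamma> t\<close> lies in
  the space itself, limit functionals satisfy \<open>f y \<le> g\<close>. A single \<open>g\<close> serves all finite sets, whence
  \<open>f y0 \<le> g\<close> by testing against the sets belonging to intervals.\<close>

lemma p_le_if_approx_minorants_le:
  assumes A: "A \<in> sets lebesgue" "A \<subseteq> {0..1}" and e: "0 < e"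
    and m: "\<And>x. x \<in> approx_minorants (p A) e \<Longrightarrow> blinfun_apply y0 x \<le> m"
  shows "p A y0 \<le> m"
proof -
  interpret finite_measure "lebesgue_on {0..1::real}" by (rule finite_measure_lebesgue_on_01)
  let ?M = "lebesgue_on {0..1::real}"
  have "0 \<in> approx_minorants (p A) e"
    using p_nonneg[OF A] e by (simp add: approx_minorants_def)
  from m[OF this] have m0: "0 \<le> m" by simp
  obtain C where C: "C \<ge> 0" "\<And>y. p {0..1} y \<le> C * norm y" using p_bounded by blast
  \<comment> \<open>As \<open>p A\<close> is nonnegative,
    \<open>p A y + e * norm y \<le> m + 1\<close> forces \<open>norm y \<le> R\<close>; the
    tolerances \<open>1 / (real n + 1)\<close> never exceed 1.\<close>
  define R where "R = (m + 1) / e"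
  \<comment> \<open>\<open>F\<close> and \<open>n\<close> encode a weak-star neighbourhood of
    \<open>y0\<close>. Collecting majorants of \<open>f y\<close> instead of the functions
    \<open>f y\<close> themselves makes \<open>E F n\<close> closed under midpoints, by sublinearity
    in \<open>y\<close>.\<close>
  define E where "E F n = {h. integrable ?M h \<and> (LINT t:A|lebesgue. h t) \<le> m + 1 / (real n + 1) \<and>
      (\<integral>t. h t \<partial>?M) \<le> C * R \<and>
      (\<exists>y. (\<forall>x\<in>F. \<bar>blinfun_apply y x - blinfun_apply y0 x\<bar> \<le> 1 / (real n + 1)) \<and> norm y \<le> R \<and>
        (AE t in ?M. f y t \<le> h t))}" for F n
  define \<E> where "\<E> = {E F n | F n. finite F}"
  have inE: "integrable ?M h" "(LINT t:A|lebesgue. h t) \<le> m + 1 / (real n + 1)" "(\<integral>t. h t \<partial>?M) \<le> C * R"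
      "\<exists>y. (\<forall>x\<in>F. \<bar>blinfun_apply y x - blinfun_apply y0 x\<bar> \<le> 1 / (real n + 1)) \<and> norm y \<le> R \<and>
        (AE t in ?M. f y t \<le> h t)" if "h \<in> E F n" for h F n
    using that by (auto simp: E_def)
  have nn: "AE t in ?M. 0 \<le> h t" if h: "h \<in> E F n" for h F n
  proof -
    obtain y where "AE t in ?M. f y t \<le> h t" using inE(4)[OF h] by blast
    with f_nonneg[of y] show ?thesis by eventually_elim simp
  qed
  obtain g where g: "g \<in> borel_measurable ?M"
    "\<And>D. D \<in> \<E> \<Longrightarrow> \<exists>h. (\<forall>n::nat. h n \<in> D) \<and> (AE t in ?M. (\<lambda>n. h n t) \<longlonglongrightarrow> g t)"
  proof (rule directed_convex_AE_limit[of \<E> "C * R"])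
    show "\<E> \<noteq> {}" by (auto simp: \<E>_def)
    fix D assume "D \<in> \<E>"
    then obtain F n where D: "D = E F n" "finite F" by (auto simp: \<E>_def)
    show "D \<noteq> {}"
    proof -
      obtain y where y: "\<forall>x\<in>F. \<bar>blinfun_apply y x - blinfun_apply y0 x\<bar> \<le> 1 / (real n + 1)"
        "p A y + e * norm y \<le> m + 1 / (real n + 1)"
        using finite_approximants[OF p_sublinear[OF A] e m D(2), of "1 / (real n + 1)"] by auto
      have "1 / (real n + 1) \<le> 1" by simp
      then have "e * norm y \<le> m + 1" using y(2) p_nonneg[OF A, of y] by linarith
      then have nR: "norm y \<le> R" using e by (simp add: R_def field_simps)
      have "p {0..1} y \<le> C * norm y" by (rule C(2))
      also have "\<dots> \<le> C * R" using nR C(1) by (rule mult_left_mono)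
      finally have "(\<integral>t. f y t \<partial>?M) \<le> C * R" by (simp add: integral_lebesgue_on_01)
      moreover have "p A y \<le> m + 1 / (real n + 1)"
      proof -
        have "0 \<le> e * norm y" using e by simp
        with y(2) show ?thesis by linarith
      qed
      ultimately have "f y \<in> E F n"
        using f_int y(1) nR unfolding E_def by blast
      then show ?thesis using D by blast
    qed
    fix h assume h: "h \<in> D"
    show "integrable ?M h" "AE t in ?M. 0 \<le> h t" "(\<integral>t. h t \<partial>?M) \<le> C * R"
      using inE[of h F n] nn[of h F n] h by (auto simp: D)
    fix k assume k: "k \<in> D"
    show "(\<lambda>t. (h t + k t) / 2) \<in> D"
    proof -
      note hE = inE[OF h[unfolded D]] and kE = inE[OF k[unfolded D]]
      obtain y where y: "\<forall>x\<in>F. \<bar>blinfun_apply y x - blinfun_apply y0 x\<bar> \<le> 1 / (real n + 1)" "norm y \<le> R"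
        "AE t in ?M. f y t \<le> h t" using hE(4) by blast
      obtain z where z: "\<forall>x\<in>F. \<bar>blinfun_apply z x - blinfun_apply y0 x\<bar> \<le> 1 / (real n + 1)" "norm z \<le> R"
        "AE t in ?M. f z t \<le> k t" using kE(4) by blast
      define w where "w = (1 / 2) *\<^sub>R (y + z)"
      have "\<bar>blinfun_apply w x - blinfun_apply y0 x\<bar> \<le> 1 / (real n + 1)" if "x \<in> F" for x
      proof -
        have "\<bar>blinfun_apply y x - blinfun_apply y0 x\<bar> \<le> 1 / (real n + 1)"
          "\<bar>blinfun_apply z x - blinfun_apply y0 x\<bar> \<le> 1 / (real n + 1)" using y(1) z(1) that by auto
        then have "\<bar>((blinfun_apply y x - blinfun_apply y0 x) + (blinfun_apply z x - blinfun_apply y0 x)) / 2\<bar>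
            \<le> 1 / (real n + 1)"
          using abs_triangle_ineq[of "blinfun_apply y x - blinfun_apply y0 x" "blinfun_apply z x - blinfun_apply y0 x"]
          by simp
        moreover have "blinfun_apply w x - blinfun_apply y0 x =
            ((blinfun_apply y x - blinfun_apply y0 x) + (blinfun_apply z x - blinfun_apply y0 x)) / 2"
          by (simp add: w_def blinfun.scaleR_left blinfun.add_left field_simps)
        ultimately show ?thesis by simp
      qed
      moreover have "norm w \<le> R"
        using norm_triangle_ineq[of y z] y(2) z(2) by (simp add: w_def)
      moreover have "AE t in ?M. f w t \<le> (h t + k t) / 2"
        using y(3) z(3) f_add[of y z] f_scaleR[of "1 / 2" "y + z", simplified]
        by eventually_elim (simp add: w_def)
      moreover have "integrable ?M (\<lambda>t. (h t + k t) / 2)" using hE(1) kE(1) by simp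
      moreover have "(\<integral>t. (h t + k t) / 2 \<partial>?M) \<le> C * R" using hE(1,3) kE(1,3) by simp
      moreover have "(LINT t:A|lebesgue. (h t + k t) / 2) \<le> m + 1 / (real n + 1)"
      proof -
        note si = set_integrable_lebesgue_01[OF hE(1) A] set_integrable_lebesgue_01[OF kE(1) A]
        have "(LINT t:A|lebesgue. (h t + k t) / 2)
            = ((LINT t:A|lebesgue. h t) + (LINT t:A|lebesgue. k t)) / 2"
          unfolding set_integral_add(2)[OF si, symmetric] by simp
        then show ?thesis using hE(2) kE(2) by simp
      qed
      ultimately show ?thesis unfolding D(1) E_def by blast
    qed
  next
    fix D D' assume "D \<in> \<E>" "D' \<in> \<E>"
    then obtain F n F' n' where D: "D = E F n" "finite F" "D' = E F' n'" "finite F'"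
      by (auto simp: \<E>_def)
    have sub: "E (F \<union> F') (max n n') \<subseteq> E F'' k" if "F'' \<subseteq> F \<union> F'" "k \<le> max n n'" for F'' k
    proof
      fix h assume h: "h \<in> E (F \<union> F') (max n n')"
      have le: "1 / (real (max n n') + 1) \<le> 1 / (real k + 1)"
        using that(2) by (intro divide_left_mono) auto
      obtain y where "\<forall>x\<in>F \<union> F'. \<bar>blinfun_apply y x - blinfun_apply y0 x\<bar> \<le> 1 / (real (max n n') + 1)"
        "norm y \<le> R" "AE t in ?M. f y t \<le> h t" using inE(4)[OF h] by blast
      moreover from this(1) le that(1)
      have "\<forall>x\<in>F''. \<bar>blinfun_apply y x - blinfun_apply y0 x\<bar> \<le> 1 / (real k + 1)"
        by (auto intro: order_trans)
      moreover have "(LINT t:A|lebesgue. h t) \<le> m + 1 / (real k + 1)" using inE(2)[OF h] le by linarith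
      ultimately show "h \<in> E F'' k" using inE(1,3)[OF h] unfolding E_def by blast
    qed
    have "E (F \<union> F') (max n n') \<in> \<E>" using D by (auto simp: \<E>_def)
    moreover have "E (F \<union> F') (max n n') \<subseteq> D \<inter> D'" using sub[of F n] sub[of F' n'] D by auto
    ultimately show "\<exists>D''\<in>\<E>. D'' \<subseteq> D \<inter> D'" by blast
  qed blast
  have seq: "\<exists>h. (\<forall>k::nat. h k \<in> E F n) \<and> (AE t in ?M. (\<lambda>k. h k t) \<longlonglongrightarrow> g t)" if "finite F" for F n
    by (rule g(2)) (use that in \<open>auto simp: \<E>_def\<close>)
  have g_int: "integrable ?M g"
  proof -
    obtain h where h: "\<And>k::nat. h k \<in> E {} 0" "AE t in ?M. (\<lambda>k. h k t) \<longlonglongrightarrow> g t"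
      using seq[of "{}" 0] by auto
    show ?thesis
      by (rule integral_le_of_AE_limit(1)[OF inE(1)[OF h(1)] nn[OF h(1)] inE(3)[OF h(1)] g(1) h(2)])
  qed
  have g_A: "(LINT t:A|lebesgue. g t) \<le> m + 1 / (real n + 1)" for n
  proof -
    obtain h where h: "\<And>k::nat. h k \<in> E {} n" "AE t in ?M. (\<lambda>k. h k t) \<longlonglongrightarrow> g t"
      using seq[of "{}" n] by auto
    have "(\<integral>t. indicator A t * g t \<partial>?M) \<le> m + 1 / (real n + 1)"
    proof (rule integral_le_of_AE_limit(2))
      have AM: "A \<in> sets ?M" using A by (simp add: sets_restrict_space_iff)
      show "integrable ?M (\<lambda>t. indicator A t * h k t)" for k
        using integrable_mult_indicator[OF AM inE(1)[OF h(1)], of k] by simp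
      show "AE t in ?M. 0 \<le> indicator A t * h k t" for k
        using nn[OF h(1), of k] by eventually_elim simp
      show "(\<integral>t. indicator A t * h k t \<partial>?M) \<le> m + 1 / (real n + 1)" for k
        using inE(2)[OF h(1), of k] by (simp add: set_integral_indicator_01[OF A(2)])
      show "(\<lambda>t. indicator A t * g t) \<in> borel_measurable ?M"
        using AM g(1) by (intro borel_measurable_times borel_measurable_indicator)
      show "AE t in ?M. (\<lambda>k. indicator A t * h k t) \<longlonglongrightarrow> indicator A t * g t"
        using h(2) by eventually_elim (intro tendsto_mult tendsto_const)
    qed
    then show ?thesis by (simp add: set_integral_indicator_01[OF A(2)])
  qed
  \<comment> \<open>For a fixed \<open>x\<close> in the set \<open>N\<close> of the interval the
    one-point constraint \<open>{x}\<close> suffices; as \<open>g\<close> does not depend on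
    \<open>x\<close>, the bounds combine into one for the support function of
    \<open>N\<close>.\<close>
  have "p {a..b} y0 \<le> (LINT t:{a..b}|lebesgue. g t)" if ab: "0 \<le> a" "a \<le> b" "b \<le> 1" for a b
  proof -
    have I: "{a..b} \<in> sets lebesgue" "{a..b} \<subseteq> {0..1}" using ab by auto
    obtain N where N: "\<And>y. support_fun y N = ereal (p {a..b} y)" using interval[OF ab] by blast
    have "blinfun_apply y0 x \<le> (LINT t:{a..b}|lebesgue. g t)" if x: "x \<in> N" for x
    proof (rule field_le_epsilon)
      fix \<epsilon> :: real assume "0 < \<epsilon>"
      then obtain n where "1 / real (Suc n) < \<epsilon>" by (rule nat_approx_posE)
      then have n: "1 / (real n + 1) < \<epsilon>" by (simp add: add.commute)
      obtain h where h: "\<And>k::nat. h k \<in> E {x} n" "AE t in ?M. (\<lambda>k. h k t) \<longlonglongrightarrow> g t"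
        using seq[of "{x}" n] by auto
      have "\<forall>k. \<exists>y. \<bar>blinfun_apply y x - blinfun_apply y0 x\<bar> \<le> 1 / (real n + 1) \<and> norm y \<le> R \<and>
          (AE t in ?M. f y t \<le> h k t)"
        using inE(4)[OF h(1)] by simp
      then obtain y where "\<forall>k. \<bar>blinfun_apply (y k) x - blinfun_apply y0 x\<bar> \<le> 1 / (real n + 1) \<and>
          norm (y k) \<le> R \<and> (AE t in ?M. f (y k) t \<le> h k t)"
        by (rule choice[THEN exE])
      then have y: "\<And>k. \<bar>blinfun_apply (y k) x - blinfun_apply y0 x\<bar> \<le> 1 / (real n + 1)"
        "\<And>k. norm (y k) \<le> R" "\<And>k. AE t in ?M. f (y k) t \<le> h k t" by auto
      obtain \<phi> :: "'a \<Rightarrow>\<^sub>L real" where \<phi>: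
        "\<And>x c. eventually (\<lambda>k. blinfun_apply (y k) x \<le> c) sequentially \<Longrightarrow> blinfun_apply \<phi> x \<le> c"
        using bounded_sequence_limit_functional[of y R, OF y(2)] by blast
      have "AE t in ?M. \<forall>k. f (y k) t \<le> h k t" using y(3) by (simp add: AE_all_countable)
      moreover have "AE t in ?M. \<forall>k. support_fun (y k) (\<Gamma> t) = ereal (f (y k) t)"
        using f_eq by (simp only: AE_all_countable) simp
      ultimately have "AE t in ?M. f \<phi> t \<le> g t"
        using h(2) f_eq[of \<phi>]
      proof eventually_elim
        case (elim t)
        \<comment> \<open>Evaluation at a point \<open>z\<close> of the space passes eventual bounds
          on to \<open>\<phi>\<close>, and \<open>h k t\<close> tends to \<open>g t\<close>.\<close>
        have "blinfun_apply \<phi> z \<le> g t" if z: "z \<in> \<Gamma> t" for z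
        proof (rule field_le_epsilon)
          fix \<eta> :: real assume "0 < \<eta>"
          then have "eventually (\<lambda>k. h k t < g t + \<eta>) sequentially"
            using elim(3) by (intro order_tendstoD(2)) auto
          then have "eventually (\<lambda>k. blinfun_apply (y k) z \<le> g t + \<eta>) sequentially"
          proof eventually_elim
            case less: (elim k)
            have "ereal (blinfun_apply (y k) z) \<le> ereal (f (y k) t)"
              using le_support_fun[OF z] elim(2)[rule_format] by (rule ord_le_eq_trans)
            then have "blinfun_apply (y k) z \<le> f (y k) t" by simp
            also have "\<dots> \<le> h k t" using elim(1) by simp
            finally show ?case using less by simp
          qed
          then show "blinfun_apply \<phi> z \<le> g t + \<eta>" by (rule \<phi>)
        qed
        then have "support_fun \<phi> (\<Gamma> t) \<le> ereal (g t)" by (simp add: support_fun_le_iff)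
        with elim(4) have "ereal (f \<phi> t) \<le> ereal (g t)" by (rule ord_eq_le_trans[OF sym])
        then show "f \<phi> t \<le> g t" by (simp only: ereal_less_eq(3))
      qed
      then have "p {a..b} \<phi> \<le> (LINT t:{a..b}|lebesgue. g t)"
        by (rule set_integral_mono_01[OF f_int g_int _ I])
      moreover have "blinfun_apply \<phi> x \<le> p {a..b} \<phi>"
        using le_support_fun[OF x, of \<phi>] by (simp add: N)
      \<comment> \<open>\<open>\<phi>\<close> inherits upper bounds only; a lower bound at
        \<open>x\<close> is an upper bound at \<open>- x\<close>.\<close>
      moreover have "blinfun_apply \<phi> (- x) \<le> - blinfun_apply y0 x + 1 / (real n + 1)"
      proof (intro \<phi> always_eventually allI)
        show "blinfun_apply (y k) (- x) \<le> - blinfun_apply y0 x + 1 / (real n + 1)" for k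
          using y(1)[of k] by (simp add: blinfun.minus_right abs_le_iff)
      qed
      ultimately show "blinfun_apply y0 x \<le> (LINT t:{a..b}|lebesgue. g t) + \<epsilon>"
        using n by (simp add: blinfun.minus_right)
    qed
    then have "support_fun y0 N \<le> ereal (LINT t:{a..b}|lebesgue. g t)" by (simp add: support_fun_le_iff)
    then show ?thesis by (simp add: N)
  qed
  \<comment> \<open>Differentiation carries the inequality from intervals to almost every point, and
    from there it reaches the measurable set \<open>A\<close>.\<close>
  then have "AE t in ?M. f y0 t \<le> g t"
    using set_integrable_lebesgue_01[OF f_int] set_integrable_lebesgue_01[OF g_int]
    by (intro AE_le_if_interval_integrals_le) auto
  then have "p A y0 \<le> (LINT t:A|lebesgue. g t)" by (rule set_integral_mono_01[OF f_int g_int _ A])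
  moreover have "(LINT t:A|lebesgue. g t) \<le> m"
  proof (rule field_le_epsilon)
    fix \<epsilon> :: real assume "0 < \<epsilon>"
    then obtain n where "1 / real (Suc n) < \<epsilon>" by (rule nat_approx_posE)
    then have "1 / (real n + 1) < \<epsilon>" by (simp add: add.commute)
    with g_A[of n] show "(LINT t:A|lebesgue. g t) \<le> m + \<epsilon>" by linarith
  qed
  ultimately show ?thesis by simp
qed

lemma support_fun_minorants:
  assumes A: "A \<in> sets lebesgue" "A \<subseteq> {0..1}"
  shows "support_fun y (approx_minorants (p A) 0) = ereal (p A y)"
proof (rule antisym)
  show "support_fun y (approx_minorants (p A) 0) \<le> ereal (p A y)"
    by (simp add: support_fun_le_iff approx_minorants_def)
  have ne: "approx_minorants (p A) e \<noteq> {}" if "0 < e" for e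
    using p_nonneg[OF A] that by (auto simp: approx_minorants_def intro!: exI[of _ 0])
  show "ereal (p A y) \<le> support_fun y (approx_minorants (p A) 0)"
  proof (rule ereal_le_epsilon2)
    fix \<eta> :: real assume "0 < \<eta>"
    have "\<exists>x\<in>approx_minorants (p A) 0. p A y - \<eta> \<le> blinfun_apply y x"
    proof (rule exact_minorant[OF ne _ \<open>0 < \<eta>\<close>])
      fix e m :: real and z :: "'a \<Rightarrow>\<^sub>L real"
      assume "0 < e" "\<And>x. x \<in> approx_minorants (p A) e \<Longrightarrow> blinfun_apply z x \<le> m"
      then show "p A z \<le> m" by (rule p_le_if_approx_minorants_le[OF A])
    qed
    then obtain x where x: "x \<in> approx_minorants (p A) 0" "p A y - \<eta> \<le> blinfun_apply y x" by blast
    have "ereal (p A y) \<le> ereal (blinfun_apply y x) + ereal \<eta>" using x(2) by simp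
    also have "\<dots> \<le> support_fun y (approx_minorants (p A) 0) + ereal \<eta>"
      by (intro add_right_mono le_support_fun x)
    finally show "ereal (p A y) \<le> support_fun y (approx_minorants (p A) 0) + ereal \<eta>" .
  qed
qed

text \<open>A point outside the closed convex set \<open>N\<close> is strictly separated from it by
  some \<open>\<phi>\<close>, whose value there then exceeds \<open>p {0..1} \<phi>\<close>;
  positivity makes this at least \<open>p A \<phi>\<close>.\<close>

lemma minorants_subset:
  assumes A: "A \<in> sets lebesgue" "A \<subseteq> {0..1}"
    and N: "N \<in> c_sets" "\<And>y. support_fun y N = ereal (p {0..1} y)"
  shows "approx_minorants (p A) 0 \<subseteq> N"
proof (rule ccontr)
  assume "\<not> ?thesis"
  then obtain x where x: "x \<in> approx_minorants (p A) 0" "x \<notin> N" by blast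
  have N': "closed N" "convex N" "N \<noteq> {}" using N(1) by (auto simp: c_sets_def)
  define d where "d = infdist x N"
  have "d > 0" using N' x(2) by (simp add: d_def infdist_pos_not_in_closed)
  have "d \<le> dist x c" if "c \<in> N" for c using that by (simp add: d_def infdist_le)
  then obtain \<phi> :: "'a \<Rightarrow>\<^sub>L real" where "\<And>c. c \<in> N \<Longrightarrow> blinfun_apply \<phi> c \<le> blinfun_apply \<phi> x - d"
    using Hahn_Banach_separation_setdist[OF N'(2,3)] by metis
  then have "support_fun \<phi> N \<le> ereal (blinfun_apply \<phi> x - d)" by (simp add: support_fun_le_iff)
  then have "p {0..1} \<phi> \<le> blinfun_apply \<phi> x - d" by (simp add: N(2))
  moreover have "blinfun_apply \<phi> x \<le> p A \<phi>" using x(1) by (simp add: approx_minorants_def)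
  ultimately show False using p_mono[OF A, of \<phi>] \<open>d > 0\<close> by simp
qed

end

section \<open>Transfer to the three families of sets\<close>

text \<open>The form as an intersection of half-spaces gives weak closedness directly, without
  passing through norm-closed convex sets.\<close>

lemma closedin_weak_topology_minorants: "closedin weak_topology (approx_minorants p 0)"
proof -
  have open_in: "openin weak_topology (blinfun_apply y -` U)" if "open U"
    for y :: "'a \<Rightarrow>\<^sub>L real" and U
    unfolding weak_topology_def using that by (intro topology_generated_by_Basis) auto
  have top: "topspace weak_topology = (UNIV :: 'a set)"
    using openin_subset[OF open_in[of UNIV "0 :: 'a \<Rightarrow>\<^sub>L real"]] by auto
  have "UNIV - approx_minorants p 0 = (\<Union>y. blinfun_apply y -` {p y<..})"
    by (auto simp: approx_minorants_def simp flip: not_le)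
  moreover have "openin weak_topology (\<Union>y. blinfun_apply y -` {p y<..})"
    by (intro openin_Union) (auto intro: open_in)
  ultimately show ?thesis by (simp add: closedin_def top)
qed

text \<open>The family matters only through \<open>hered\<close>: the integral over any measurable
  set is a set of exact minorants inside the integral over \<open>{0..1}\<close>.\<close>

lemma DP_integrable_imp_Pettis_integrable:
  fixes \<Gamma> :: "real \<Rightarrow> 'a::banach set"
  assumes \<Gamma>: "\<And>t. t \<in> {0..1} \<Longrightarrow> \<Gamma> t \<in> c_sets" and pos: "positive_multifunction \<Gamma>"
    and DP: "DP_integrable_in \<C> \<Gamma>"
    and sub: "\<C> \<subseteq> c_sets"
    and hered: "\<And>N p. N \<in> \<C> \<Longrightarrow> approx_minorants p 0 \<noteq> {} \<Longrightarrow> approx_minorants p 0 \<subseteq> N \<Longrightarrow> approx_minorants p 0 \<in> \<C>"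
  shows "Pettis_integrable_in \<C> \<Gamma>"
proof -
  have pos': "AE t in lebesgue_on {0..1}. 0 \<le> support_fun y (\<Gamma> t)" for y
    using pos by (simp add: positive_multifunction_def)
  have leb: "lebesgue_integrable (\<lambda>t. support_fun y (\<Gamma> t))" for y
  proof -
    obtain F where "denjoy_primitive F (\<lambda>t. support_fun y (\<Gamma> t))"
      using DP unfolding DP_integrable_in_def denjoy_integrable_def by blast
    then show ?thesis using pos' by (rule denjoy_primitive_nonneg(1))
  qed
  have intv: "\<exists>N\<in>\<C>. \<forall>y. support_fun y N =
      ereal (LINT t:{a..b}|lebesgue. real_of_ereal (support_fun y (\<Gamma> t)))"
    if ab: "0 \<le> a" "a \<le> b" "b \<le> 1" for a b
  proof -
    obtain N where N: "N \<in> \<C>" "\<And>y. \<exists>v. has_denjoy_integral (\<lambda>t. support_fun y (\<Gamma> t)) a b v \<and>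
        support_fun y N = ereal v"
      using DP ab unfolding DP_integrable_in_def by meson
    \<comment> \<open>The Denjoy integral may be witnessed by a different primitive for each
      \<open>y\<close> and each interval; the Lebesgue integral is the same for all of them.\<close>
    have "support_fun y N = ereal (LINT t:{a..b}|lebesgue. real_of_ereal (support_fun y (\<Gamma> t)))" for y
    proof -
      obtain F where "denjoy_primitive F (\<lambda>t. support_fun y (\<Gamma> t))" "support_fun y N = ereal (F b - F a)"
        using N(2)[of y] by (auto simp: has_denjoy_integral_def)
      with denjoy_primitive_nonneg(2)[OF _ pos' ab] show ?thesis by simp
    qed
    with N(1) show ?thesis by blast
  qed
  interpret positive_interval_integrable \<Gamma>
  proof
    show "\<Gamma> t \<noteq> {}" if "t \<in> {0..1}" for t using \<Gamma>[OF that] by (simp add: c_sets_def)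
    show "\<exists>N. \<forall>y. support_fun y N =
      ereal (LINT t:{a..b}|lebesgue. real_of_ereal (support_fun y (\<Gamma> t)))"
      if "0 \<le> a" "a \<le> b" "b \<le> 1" for a b
      using intv[OF that] by blast
  qed (rule pos' leb)+
  obtain N where N: "N \<in> \<C>" "\<And>y. support_fun y N = ereal (p {0..1} y)"
    using intv[of 0 1] by auto
  have "N \<in> c_sets" using N(1) sub by auto
  show ?thesis
    unfolding Pettis_integrable_in_def
  proof (intro conjI allI ballI impI)
    show "lebesgue_integrable (\<lambda>t. support_fun y (\<Gamma> t))" for y by (rule leb)
    fix A :: "real set" assume A: "A \<in> sets lebesgue" "A \<subseteq> {0..1}"
    have "0 \<in> approx_minorants (p A) 0" using p_nonneg[OF A] by (simp add: approx_minorants_def)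
    then have "approx_minorants (p A) 0 \<in> \<C>"
      using minorants_subset[OF A \<open>N \<in> c_sets\<close> N(2)] by (intro hered[OF N(1)]) auto
    with support_fun_minorants[OF A]
    show "\<exists>M\<in>\<C>. \<forall>y. support_fun y M = ereal (p A y)" by blast
  qed
qed

theorem theorem3p3:
  fixes \<Gamma> :: "real \<Rightarrow> 'a::banach set"
  assumes "\<And>t. t \<in> {0..1} \<Longrightarrow> \<Gamma> t \<in> c_sets"
    and "positive_multifunction \<Gamma>"
  shows "(DP_integrable_in cb_sets \<Gamma> \<longrightarrow> Pettis_integrable_in cb_sets \<Gamma>) \<and>
         (DP_integrable_in cwk_sets \<Gamma> \<longrightarrow> Pettis_integrable_in cwk_sets \<Gamma>) \<and>
         (DP_integrable_in ck_sets \<Gamma> \<longrightarrow> Pettis_integrable_in ck_sets \<Gamma>)"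
proof -
  have minorants: "approx_minorants q 0 \<in> c_sets" if "approx_minorants q 0 \<noteq> {}"
    for q :: "('a \<Rightarrow>\<^sub>L real) \<Rightarrow> real"
    using that by (simp add: c_sets_def closed_approx_minorants convex_approx_minorants)
  have compact: "compact S" if "compact N" "closed S" "S \<subseteq> N" for S N :: "'a set"
    using compact_Int_closed[OF that(1,2)] that(3) by (simp add: Int_absorb1)
  show ?thesis
  proof (intro conjI impI)
    assume DP: "DP_integrable_in cb_sets \<Gamma>"
    show "Pettis_integrable_in cb_sets \<Gamma>"
      by (rule DP_integrable_imp_Pettis_integrable[OF assms DP])
        (auto simp: cb_sets_def minorants intro: bounded_subset)
  next
    assume DP: "DP_integrable_in cwk_sets \<Gamma>"
    show "Pettis_integrable_in cwk_sets \<Gamma>"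
      by (rule DP_integrable_imp_Pettis_integrable[OF assms DP])
        (auto simp: cwk_sets_def minorants
          intro: closed_compactin closedin_weak_topology_minorants)
  next
    assume DP: "DP_integrable_in ck_sets \<Gamma>"
    show "Pettis_integrable_in ck_sets \<Gamma>"
      by (rule DP_integrable_imp_Pettis_integrable[OF assms DP])
        (auto simp: ck_sets_def minorants intro: compact closed_approx_minorants)
  qed
qed

end
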